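(* For a group $G$ with a gliding system and a set $\mathcal{E}\subset G$, the cubed complex $X_{\mathcal{E}}$ is nonpositively curved if and only if $\mathcal{E}$ is regular and meets the following 3-cube condition: if $A\in\mathcal{E}$ and pairwise independent glides $s_1,s_2,s_3\in G$ satisfy $s_1A,\ s_2A,\ s_3A,\ s_1s_2A,\ s_1s_3A,\ s_2s_3A\in\mathcal{E}$, then $s_1s_2s_3A\in\mathcal{E}$.
   Context: A gliding system in a group $G$ is a pair of sets $(\mathcal{G}\subset G\setminus\{1\},\ \mathcal{I}\subset\mathcal{G}\times\mathcal{G})$ such that: (1) if $s\in\mathcal{G}$ then $s^{-1}\in\mathcal{G}$; (2) if $(s,t)\in\mathcal{I}$ then $st=ts$, $(s^{-1},t)\in\mathcal{I}$ and $(t,s)\in\mathcal{I}$; (3) $(s,s)\notin\mathcal{I}$ for all $s\in\mathcal{G}$. Elements of $\mathcal{G}$ are called glides; glides $s,t$ are independent if $(s,t)\in\mathcal{I}$. A set of independent glides is a set $S\subset\mathcal{G}$ whose distinct elements are pairwise independent; for finite such $S$ put $[S]=\prod_{s\in S}s\in G$, $[\emptyset]=1$. A set of glides $S$ is cubic if it is finite, its elements are pairwise independent, and $[T_1]\ne[T_2]$ for any distinct subsets $T_1,T_2\subset S$. For $T\subset S$ put $S_T=(S\setminus T)\cup\{t^{-1}\}_{t\in T}$. A based cube in $G$ is a pair $(A,S)$ with $A\in G$ and $S$ a cubic set of glides; its dimension is $\mathrm{card}(S)$ and its vertices are the elements $[T]A$, $T\subset S$. Based cubes $(A,S)$ and $([T]A,S_T)$,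 $T\subset S$, are equivalent; equivalence classes of $k$-dimensional based cubes are $k$-cubes in $G$. A cube $Q$ is a face of $Q'$ if they are represented by based cubes $(A,S)$, $(A,S')$ with $S\subset S'$. The cubed complex $X_G$ has one copy of $[0,1]^k$ for each $k$-cube in $G$, glued along face inclusions; precisely its points are represented by triples $(A,S,x)$ with $(A,S)$ a based cube and $x:S\to[0,1]$, modulo the equivalence relation generated by: $(A,S,x)\sim(A,S',x')$ if $S\subset S'$, $x=x'|_S$, $x'(S'\setminus S)=0$; and $(A,S,x)\sim([T]A,S_T,x')$ if $T\subset S$, $x'=x$ on $S\setminus T$, $x'(t^{-1})=1-x(t)$ for $t\in T$. For $\mathcal{E}\subset G$, the glide complex $X_{\mathcal{E}}\subset X_G$ is formed by the cubes all of whose vertices lie in $\mathcal{E}$. A set $\mathcal{E}\subset G$ is regular if for every $A\in\mathcal{E}$, every finite set $S\subset G$ of independent glides such that $sA\in\mathcal{E}$ for all $s\in S$ and $stA\in\mathcal{E}$ for all distinct $s,t\in S$ is cubic. The link of a $0$-cell $A$ of a cubed complex is the space of directions at $A$; each triple ($k\ge1$, a vertex $a$ of $[0,1]^k$, a $k$-cell carrying $a$ to $A$) determines a $(k-1)$-dimensional simplex in it. A cubed complex is simple if the links of all $0$-cells are simplicial complexes, i.e. all these simplices are embedded and the intersection of any two is a common face. A flag complex is a simplicial complex in which any finite collection of pairwise adjacent vertices spans a simplex. A cubed complex is nonpositively curved if it is simple and the link of each $0$-cell is a flag complex. *)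

theory Defs
  imports "HOL-Analysis.Analysis" "HOL-Algebra.FiniteProduct"
begin

text \<open>
  A cubed complex is recorded by its set of cells and, for each cell \<open>c\<close>, the finite set
  \<open>axes X c\<close> of coordinate directions (so that the dimension of \<open>c\<close> is \<open>card (axes X c)\<close>) and the
  map \<open>char_map X c\<close> from the cube \<open>[0,1]\<close> to the power \<open>axes X c\<close> into the set of points of the
  complex.  Coordinates are indexed by an arbitrary finite set instead of \<open>{1..k}\<close>, since the cubes
  in a group have no preferred ordering of their axes.  The link conditions below do not refer to
  the weak topology of the complex: germs of rays are compared inside the glued point set.
\<close>

record ('c, 'i, 'p) cubed_complex =
  cells :: "'c set"
  axes :: "'c \<Rightarrow> 'i set"
  char_map :: "'c \<Rightarrow> ('i \<Rightarrow> real) \<Rightarrow> 'p"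

definition zero_cells :: "('c, 'i, 'p) cubed_complex \<Rightarrow> 'p set" where
  "zero_cells X = {char_map X c (\<lambda>_. undefined) | c. c \<in> cells X \<and> axes X c = {}}"

definition corners :: "('c, 'i, 'p) cubed_complex \<Rightarrow> 'p \<Rightarrow> ('c \<times> ('i \<Rightarrow> real)) set" where
  "corners X p = {(c, a). c \<in> cells X \<and> axes X c \<noteq> {}
     \<and> a \<in> axes X c \<rightarrow>\<^sub>E {0, 1} \<and> char_map X c a = p}"

definition std_simplex :: "'i set \<Rightarrow> ('i \<Rightarrow> real) set" where
  "std_simplex J = {v \<in> J \<rightarrow>\<^sub>E {0..}. sum v J = 1}"

text \<open>
  The straight ray leaving the corner \<open>(c, a)\<close> into the cube with speed \<open>v i\<close> along the axis \<open>i\<close>.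
  Directions at a corner are normalised by \<open>sum v = 1\<close>, a normalisation that is preserved by the
  isometries along which faces of cubes are glued.
\<close>

definition ray :: "('c, 'i, 'p) cubed_complex \<Rightarrow> 'c \<times> ('i \<Rightarrow> real) \<Rightarrow> ('i \<Rightarrow> real) \<Rightarrow> real \<Rightarrow> 'p" where
  "ray X \<sigma> v \<epsilon> = (case \<sigma> of (c, a) \<Rightarrow>
     char_map X c (\<lambda>i \<in> axes X c. if a i = 0 then \<epsilon> * v i else 1 - \<epsilon> * v i))"

text \<open>
  A direction at \<open>p\<close> is a germ of rays at \<open>p\<close>: two rays have the same direction if they coincide
  in the complex for all sufficiently small positive times.
\<close>

definition same_germ ::
  "('c, 'i, 'p) cubed_complex \<Rightarrow> 'p \<Rightarrow>
   ((('c \<times> ('i \<Rightarrow> real)) \<times> ('i \<Rightarrow> real)) \<times> (('c \<times> ('i \<Rightarrow> real)) \<times> ('i \<Rightarrow> real))) set" where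
  "same_germ X p = {((\<sigma>, v), (\<tau>, w)).
     \<sigma> \<in> corners X p \<and> v \<in> std_simplex (axes X (fst \<sigma>)) \<and>
     \<tau> \<in> corners X p \<and> w \<in> std_simplex (axes X (fst \<tau>)) \<and>
     (\<forall>\<^sub>F \<epsilon> in at_right 0. ray X \<sigma> v \<epsilon> = ray X \<tau> w \<epsilon>)}"

text \<open>
  The link of \<open>p\<close> is the set of classes \<open>direction X p \<sigma> v\<close>; each corner \<open>\<sigma>\<close> determines the simplex
  \<open>direction X p \<sigma> ` std_simplex (axes X (fst \<sigma>))\<close> in it.
\<close>

definition direction ::
  "('c, 'i, 'p) cubed_complex \<Rightarrow> 'p \<Rightarrow> 'c \<times> ('i \<Rightarrow> real) \<Rightarrow> ('i \<Rightarrow> real) \<Rightarrow>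
   (('c \<times> ('i \<Rightarrow> real)) \<times> ('i \<Rightarrow> real)) set" where
  "direction X p \<sigma> v = same_germ X p `` {(\<sigma>, v)}"

text \<open>
  The face, possibly empty, spanned by the vertices in \<open>K\<close> of the simplex of the corner \<open>\<sigma>\<close>.
\<close>

definition link_face ::
  "('c, 'i, 'p) cubed_complex \<Rightarrow> 'p \<Rightarrow> 'c \<times> ('i \<Rightarrow> real) \<Rightarrow> 'i set \<Rightarrow>
   (('c \<times> ('i \<Rightarrow> real)) \<times> ('i \<Rightarrow> real)) set set" where
  "link_face X p \<sigma> K =
     direction X p \<sigma> ` {v \<in> std_simplex (axes X (fst \<sigma>)). \<forall>i \<in> axes X (fst \<sigma>) - K. v i = 0}"

definition link_simplex ::
  "('c, 'i, 'p) cubed_complex \<Rightarrow> 'p \<Rightarrow> 'c \<times> ('i \<Rightarrow> real) \<Rightarrow>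
   (('c \<times> ('i \<Rightarrow> real)) \<times> ('i \<Rightarrow> real)) set set" where
  "link_simplex X p \<sigma> = direction X p \<sigma> ` std_simplex (axes X (fst \<sigma>))"

definition link_simplex_vertices ::
  "('c, 'i, 'p) cubed_complex \<Rightarrow> 'p \<Rightarrow> 'c \<times> ('i \<Rightarrow> real) \<Rightarrow>
   (('c \<times> ('i \<Rightarrow> real)) \<times> ('i \<Rightarrow> real)) set set" where
  "link_simplex_vertices X p \<sigma> =
     (\<lambda>i. direction X p \<sigma> (\<lambda>j \<in> axes X (fst \<sigma>). if j = i then 1 else 0)) ` axes X (fst \<sigma>)"

definition link_is_simplicial :: "('c, 'i, 'p) cubed_complex \<Rightarrow> 'p \<Rightarrow> bool" where
  "link_is_simplicial X p \<longleftrightarrow>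
     (\<forall>\<sigma> \<in> corners X p. inj_on (direction X p \<sigma>) (std_simplex (axes X (fst \<sigma>)))) \<and>
     (\<forall>\<sigma> \<in> corners X p. \<forall>\<tau> \<in> corners X p.
        \<exists>K \<subseteq> axes X (fst \<sigma>). \<exists>L \<subseteq> axes X (fst \<tau>).
          link_simplex X p \<sigma> \<inter> link_simplex X p \<tau> = link_face X p \<sigma> K \<and>
          link_simplex X p \<sigma> \<inter> link_simplex X p \<tau> = link_face X p \<tau> L)"

definition link_vertices ::
  "('c, 'i, 'p) cubed_complex \<Rightarrow> 'p \<Rightarrow> (('c \<times> ('i \<Rightarrow> real)) \<times> ('i \<Rightarrow> real)) set set" where
  "link_vertices X p = (\<Union>\<sigma> \<in> corners X p. link_simplex_vertices X p \<sigma>)"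

definition spans_link_simplex ::
  "('c, 'i, 'p) cubed_complex \<Rightarrow> 'p \<Rightarrow> (('c \<times> ('i \<Rightarrow> real)) \<times> ('i \<Rightarrow> real)) set set \<Rightarrow> bool" where
  "spans_link_simplex X p V \<longleftrightarrow> (\<exists>\<sigma> \<in> corners X p. link_simplex_vertices X p \<sigma> = V)"

definition link_adjacent ::
  "('c, 'i, 'p) cubed_complex \<Rightarrow> 'p \<Rightarrow> (('c \<times> ('i \<Rightarrow> real)) \<times> ('i \<Rightarrow> real)) set \<Rightarrow>
   (('c \<times> ('i \<Rightarrow> real)) \<times> ('i \<Rightarrow> real)) set \<Rightarrow> bool" where
  "link_adjacent X p u w \<longleftrightarrow> u \<noteq> w \<and> spans_link_simplex X p {u, w}"

definition link_is_flag :: "('c, 'i, 'p) cubed_complex \<Rightarrow> 'p \<Rightarrow> bool" where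
  "link_is_flag X p \<longleftrightarrow>
     (\<forall>V \<subseteq> link_vertices X p. finite V \<and> V \<noteq> {} \<and> pairwise (link_adjacent X p) V
        \<longrightarrow> spans_link_simplex X p V)"

definition simple_complex :: "('c, 'i, 'p) cubed_complex \<Rightarrow> bool" where
  "simple_complex X \<longleftrightarrow> (\<forall>p \<in> zero_cells X. link_is_simplicial X p)"

definition nonpositively_curved :: "('c, 'i, 'p) cubed_complex \<Rightarrow> bool" where
  "nonpositively_curved X \<longleftrightarrow> simple_complex X \<and> (\<forall>p \<in> zero_cells X. link_is_flag X p)"

locale gliding_system = group G for G (structure) +
  fixes glides :: "'a set" and indep :: "('a \<times> 'a) set"
  assumes glides_subset: "glides \<subseteq> carrier G - {\<one>}"
    and indep_subset: "indep \<subseteq> glides \<times> glides"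
    and inv_glide: "s \<in> glides \<Longrightarrow> inv s \<in> glides"
    and indep_commute: "(s, t) \<in> indep \<Longrightarrow> s \<otimes> t = t \<otimes> s"
    and indep_inv: "(s, t) \<in> indep \<Longrightarrow> (inv s, t) \<in> indep"
    and indep_sym: "(s, t) \<in> indep \<Longrightarrow> (t, s) \<in> indep"
    and indep_irrefl: "s \<in> glides \<Longrightarrow> (s, s) \<notin> indep"

definition independent_glides :: "'a set \<Rightarrow> ('a \<times> 'a) set \<Rightarrow> 'a set \<Rightarrow> bool" where
  "independent_glides glides indep S \<longleftrightarrow> S \<subseteq> glides \<and> pairwise (\<lambda>s t. (s, t) \<in> indep) S"

text \<open>
  The product of a finite set of commuting elements.  The group need not be commutative, so
  \<open>finprod\<close> is not available; the fold is well defined on finite sets of independent glides and is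
  used only for these.
\<close>

definition glide_prod :: "('a, 'b) monoid_scheme \<Rightarrow> 'a set \<Rightarrow> 'a" where
  "glide_prod G S = foldD (carrier G) (mult G) \<one>\<^bsub>G\<^esub> S"

definition cubic :: "('a, 'b) monoid_scheme \<Rightarrow> 'a set \<Rightarrow> ('a \<times> 'a) set \<Rightarrow> 'a set \<Rightarrow> bool" where
  "cubic G glides indep S \<longleftrightarrow>
     finite S \<and> independent_glides glides indep S \<and> inj_on (glide_prod G) (Pow S)"

text \<open>\<open>flip G S T\<close> is the set written \<open>S\<close> with subscript \<open>T\<close> in the literature.\<close>

definition flip :: "('a, 'b) monoid_scheme \<Rightarrow> 'a set \<Rightarrow> 'a set \<Rightarrow> 'a set" where
  "flip G S T = (S - T) \<union> (\<lambda>t. inv\<^bsub>G\<^esub> t) ` T"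

definition regular ::
  "('a, 'b) monoid_scheme \<Rightarrow> 'a set \<Rightarrow> ('a \<times> 'a) set \<Rightarrow> 'a set \<Rightarrow> bool" where
  "regular G glides indep E \<longleftrightarrow>
     (\<forall>A \<in> E. \<forall>S. finite S \<and> independent_glides glides indep S
        \<and> (\<forall>s \<in> S. s \<otimes>\<^bsub>G\<^esub> A \<in> E)
        \<and> (\<forall>s \<in> S. \<forall>t \<in> S. s \<noteq> t \<longrightarrow> (s \<otimes>\<^bsub>G\<^esub> t) \<otimes>\<^bsub>G\<^esub> A \<in> E)
        \<longrightarrow> cubic G glides indep S)"

definition based_cubes ::
  "('a, 'b) monoid_scheme \<Rightarrow> 'a set \<Rightarrow> ('a \<times> 'a) set \<Rightarrow> ('a \<times> 'a set) set" where
  "based_cubes G glides indep = {(A, S). A \<in> carrier G \<and> cubic G glides indep S}"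

definition based_cube_rel ::
  "('a, 'b) monoid_scheme \<Rightarrow> 'a set \<Rightarrow> ('a \<times> 'a) set \<Rightarrow> (('a \<times> 'a set) \<times> ('a \<times> 'a set)) set" where
  "based_cube_rel G glides indep = {((A, S), (B, S')).
     (A, S) \<in> based_cubes G glides indep \<and>
     (\<exists>T \<subseteq> S. B = glide_prod G T \<otimes>\<^bsub>G\<^esub> A \<and> S' = flip G S T)}"

definition group_cubes ::
  "('a, 'b) monoid_scheme \<Rightarrow> 'a set \<Rightarrow> ('a \<times> 'a) set \<Rightarrow> ('a \<times> 'a set) set set" where
  "group_cubes G glides indep = based_cubes G glides indep // based_cube_rel G glides indep"

definition cube_vertices :: "('a, 'b) monoid_scheme \<Rightarrow> ('a \<times> 'a set) set \<Rightarrow> 'a set" where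
  "cube_vertices G Q = {glide_prod G T \<otimes>\<^bsub>G\<^esub> A | A S T. (A, S) \<in> Q \<and> T \<subseteq> S}"

inductive glue ::
  "('a, 'b) monoid_scheme \<Rightarrow> 'a set \<Rightarrow> ('a \<times> 'a) set \<Rightarrow>
   'a \<times> 'a set \<times> ('a \<Rightarrow> real) \<Rightarrow> 'a \<times> 'a set \<times> ('a \<Rightarrow> real) \<Rightarrow> bool"
  for G glides indep where
  glue_face:
    "\<lbrakk>(A, S) \<in> based_cubes G glides indep; (A, S') \<in> based_cubes G glides indep; S \<subseteq> S';
      x \<in> S \<rightarrow>\<^sub>E {0..1}; x' \<in> S' \<rightarrow>\<^sub>E {0..1};
      \<forall>s \<in> S. x s = x' s; \<forall>s \<in> S' - S. x' s = 0\<rbrakk>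
     \<Longrightarrow> glue G glides indep (A, S, x) (A, S', x')"
| glue_flip:
    "\<lbrakk>(A, S) \<in> based_cubes G glides indep; T \<subseteq> S;
      x \<in> S \<rightarrow>\<^sub>E {0..1}; x' \<in> flip G S T \<rightarrow>\<^sub>E {0..1};
      \<forall>s \<in> S - T. x' s = x s; \<forall>t \<in> T. x' (inv\<^bsub>G\<^esub> t) = 1 - x t\<rbrakk>
     \<Longrightarrow> glue G glides indep (A, S, x) (glide_prod G T \<otimes>\<^bsub>G\<^esub> A, flip G S T, x')"

definition complex_point ::
  "('a, 'b) monoid_scheme \<Rightarrow> 'a set \<Rightarrow> ('a \<times> 'a) set \<Rightarrow>
   'a \<times> 'a set \<times> ('a \<Rightarrow> real) \<Rightarrow> ('a \<times> 'a set \<times> ('a \<Rightarrow> real)) set" where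
  "complex_point G glides indep q = {r. equivclp (glue G glides indep) q r}"

text \<open>
  The complex of all cubes in the group has exactly one cell for each cube \<open>Q\<close>; the cell is
  parametrised by means of a chosen based cube representing \<open>Q\<close>.
\<close>

definition cube_rep :: "('a \<times> 'a set) set \<Rightarrow> 'a \<times> 'a set" where
  "cube_rep Q = (SOME q. q \<in> Q)"

definition group_complex ::
  "('a, 'b) monoid_scheme \<Rightarrow> 'a set \<Rightarrow> ('a \<times> 'a) set \<Rightarrow>
   (('a \<times> 'a set) set, 'a, ('a \<times> 'a set \<times> ('a \<Rightarrow> real)) set) cubed_complex" where
  "group_complex G glides indep =
     \<lparr>cells = group_cubes G glides indep,
      axes = (\<lambda>Q. snd (cube_rep Q)),
      char_map = (\<lambda>Q x. complex_point G glides indep (fst (cube_rep Q), snd (cube_rep Q), x))\<rparr>"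

definition glide_complex ::
  "('a, 'b) monoid_scheme \<Rightarrow> 'a set \<Rightarrow> ('a \<times> 'a) set \<Rightarrow> 'a set \<Rightarrow>
   (('a \<times> 'a set) set, 'a, ('a \<times> 'a set \<times> ('a \<Rightarrow> real)) set) cubed_complex" where
  "glide_complex G glides indep E =
     (group_complex G glides indep)
       \<lparr>cells := {Q \<in> group_cubes G glides indep. cube_vertices G Q \<subseteq> E}\<rparr>"

end

theory Submission
  imports Defs
begin

text \<open>
  The cubes of the complex that have \<open>A\<close> as a vertex correspond to the cubic sets \<open>S\<close> for which all
  elements \<open>[T]A\<close> with \<open>T \<subseteq> S\<close> lie in \<open>E\<close>: each cube has exactly one representative based at
  \<open>A\<close>.  A direction at \<open>A\<close> then is a family of barycentric coordinates on such a set \<open>S\<close>, and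
  the whole proof rests on the fact that different families give different germs of rays
  (\<open>same_germ_iff\<close>).  Points of the complex are classes for a generated equivalence relation, so
  this needs an invariant of gluing.  The invariant used here is the set \<open>views\<close> of all coordinate
  descriptions of a point from those vertices at distance less than \<open>1\<close> from it in every coordinate;
  it yields \<open>point_eq_iff\<close>, by which two points close to \<open>A\<close> are equal only if their coordinates at
  \<open>A\<close>, extended by zero to all glides, are equal.

  Consequently the link of \<open>A\<close> is a union of simplices in one space of functions on the group, each
  spanned by unit coordinate vectors.  Such simplices meet in common faces, so the link is always
  simplicial (\<open>link_is_simplicial_X\<close>) and nonpositive curvature is the flag condition alone.
  Two vertices \<open>s\<close> and \<open>t\<close> of the link are adjacent if and only if they are independent and \<open>stA\<close> lies in
  \<open>E\<close>, since a pair of independent glides is always cubic.  Thus the flag condition says: if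
  \<open>S\<close> is a finite set of independent glides with \<open>sA\<close> and \<open>stA\<close> in \<open>E\<close> for all distinct \<open>s\<close>, \<open>t\<close> in \<open>S\<close>, then \<open>S\<close>
  is cubic and every \<open>[T]A\<close> lies in \<open>E\<close>.  The first half is regularity.  The second half follows from the
  3-cube condition by induction on \<open>T\<close> (\<open>glide_prod_in_E\<close>), and its case of three
  glides is the 3-cube condition.
\<close>

section \<open>Products of independent glides\<close>

text \<open>
  The bijection from the axes of a based cube \<open>(A, S)\<close> to the axes of the equivalent based cube at
  the vertex \<open>[T]A\<close>: seen from there, exactly the axes in \<open>T\<close> point in the opposite direction.
  Working with this map instead of the set \<open>flip G S T\<close> keeps track of which axis becomes which.
\<close>

definition reversal :: "('a, 'b) monoid_scheme \<Rightarrow> 'a set \<Rightarrow> 'a \<Rightarrow> 'a" where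
  "reversal G T s = (if s \<in> T then inv\<^bsub>G\<^esub> s else s)"

lemma flip_eq_image: "T \<subseteq> S \<Longrightarrow> flip G S T = reversal G T ` S"
  unfolding flip_def reversal_def by auto

context gliding_system
begin

abbreviation "indep_set \<equiv> independent_glides glides indep"
abbreviation "cubic_set \<equiv> cubic G glides indep"

lemma indep_set_subset: "indep_set S \<Longrightarrow> T \<subseteq> S \<Longrightarrow> indep_set T"
  unfolding independent_glides_def by (meson pairwise_subset subset_trans)

lemma indep_set_carrier: "indep_set S \<Longrightarrow> S \<subseteq> carrier G"
  unfolding independent_glides_def using glides_subset by blast

lemma indep_setD: "indep_set S \<Longrightarrow> s \<in> S \<Longrightarrow> t \<in> S \<Longrightarrow> s \<noteq> t \<Longrightarrow> (s, t) \<in> indep"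
  unfolding independent_glides_def pairwise_def by blast

lemma glide_carrier: "s \<in> glides \<Longrightarrow> s \<in> carrier G"
  using glides_subset by blast

lemma glide_prod_empty [simp]: "glide_prod G {} = \<one>"
  by (simp add: glide_prod_def)

lemma LCD_indep_set:
  assumes "indep_set S" shows "LCD S (carrier G) (\<otimes>)"
proof
  fix x y z assume xyz: "x \<in> S" "y \<in> S" "z \<in> carrier G"
  then have c: "x \<in> carrier G" "y \<in> carrier G"
    using indep_set_carrier[OF assms] by auto
  have "x \<otimes> y = y \<otimes> x"
    using indep_setD[OF assms] indep_commute xyz by (cases "x = y") auto
  then show "x \<otimes> (y \<otimes> z) = y \<otimes> (x \<otimes> z)"
    using c xyz by (simp add: m_assoc[symmetric])
next
  fix x y assume "x \<in> S" "y \<in> carrier G"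
  then show "x \<otimes> y \<in> carrier G" using indep_set_carrier[OF assms] by auto
qed

lemma glide_prod_insert:
  assumes "finite S" "x \<notin> S" "indep_set (insert x S)"
  shows "glide_prod G (insert x S) = x \<otimes> glide_prod G S"
  unfolding glide_prod_def
  by (rule LCD.foldD_insert[OF LCD_indep_set[OF assms(3)]]) (use assms in auto)

lemma glide_prod_closed [simp]:
  assumes "finite S" "indep_set S"
  shows "glide_prod G S \<in> carrier G"
  unfolding glide_prod_def
  by (rule LCD.foldD_closed[OF LCD_indep_set[OF assms(2)]]) (use assms in auto)

lemma glide_prod_singleton: "s \<in> glides \<Longrightarrow> glide_prod G {s} = s"
  using glide_prod_insert[of "{}" s] glide_carrier[of s]
  by (auto simp: independent_glides_def)

lemma glide_prod_Un_disjoint: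
  assumes "finite S" "finite T" "indep_set (S \<union> T)" "S \<inter> T = {}"
  shows "glide_prod G (S \<union> T) = glide_prod G S \<otimes> glide_prod G T"
  using assms(1,3,4)
proof (induction S rule: finite_induct)
  case empty
  then show ?case using assms(2) by simp
next
  case (insert x F)
  have i: "indep_set (F \<union> T)" "indep_set (insert x F)" "indep_set F" "indep_set T"
    using indep_set_subset[OF insert.prems(1)] by blast+
  have x: "x \<in> carrier G" using indep_set_carrier[OF i(2)] by auto
  have "glide_prod G (insert x F \<union> T) = x \<otimes> glide_prod G (F \<union> T)"
    using glide_prod_insert[of "F \<union> T" x] insert assms(2) by auto
  also have "\<dots> = x \<otimes> (glide_prod G F \<otimes> glide_prod G T)"
    using insert i by simp
  also have "\<dots> = glide_prod G (insert x F) \<otimes> glide_prod G T"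
    using glide_prod_insert[of F x] insert.hyps i x assms(2) by (simp add: m_assoc)
  finally show ?case .
qed

lemma glide_prod_pair:
  assumes "(s, t) \<in> indep"
  shows "s \<noteq> t" "indep_set {s, t}" "glide_prod G {s, t} = s \<otimes> t"
proof -
  have g: "s \<in> glides" "t \<in> glides" using assms indep_subset by auto
  show ne: "s \<noteq> t" using assms indep_irrefl g by auto
  show i: "indep_set {s, t}"
    using assms g indep_sym by (auto simp: independent_glides_def pairwise_def)
  show "glide_prod G {s, t} = s \<otimes> t"
    using glide_prod_insert[of "{t}" s] ne i g by (simp add: glide_prod_singleton)
qed

text \<open>
  Two axes cannot collapse when a cube is seen from another vertex: a collapse would need two
  independent glides that are inverse to each other.
\<close>

lemma reversal_inj_on:
  assumes "indep_set S"
  shows "inj_on (reversal G T) S"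
proof (rule inj_onI)
  fix s t assume st: "s \<in> S" "t \<in> S" and eq: "reversal G T s = reversal G T t"
  have c: "s \<in> carrier G" "t \<in> carrier G" using st indep_set_carrier[OF assms] by auto
  have g: "s \<in> glides" "t \<in> glides" using st assms by (auto simp: independent_glides_def)
  \<comment> \<open>Independent glides are never inverse to each other, since otherwise a glide would be
    independent of itself.\<close>
  have no_inv: "inv a \<noteq> b" if "(a, b) \<in> indep" for a b
    using indep_inv[OF that] indep_irrefl[of "inv a"] that indep_subset inv_glide by auto
  show "s = t"
  proof (rule ccontr)
    assume "s \<noteq> t"
    then have "inv s \<noteq> t" "inv t \<noteq> s"
      using indep_setD[OF assms] st no_inv by metis+
    moreover have "inv s \<noteq> inv t" using \<open>s \<noteq> t\<close> c by (metis inv_inv)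
    ultimately show False using eq \<open>s \<noteq> t\<close> unfolding reversal_def by metis
  qed
qed

text \<open>
  An axis crossed in both of two successive moves between vertices of a cube is reversed twice, hence
  not at all; so moves compose by symmetric difference.
\<close>

lemma reversal_reversal:
  assumes "indep_set S" "T \<subseteq> S" "R \<subseteq> S" "s \<in> S"
  shows "reversal G (reversal G T ` R) (reversal G T s) = reversal G (sym_diff R T) s"
proof -
  have "reversal G T s \<in> reversal G T ` R \<longleftrightarrow> s \<in> R"
    using inj_on_image_mem_iff[OF reversal_inj_on[OF assms(1)] assms(4,3)] .
  moreover have "inv (inv s) = s" using assms(4) indep_set_carrier[OF assms(1)] by auto
  ultimately show ?thesis
    using assms by (simp add: reversal_def)
qed

lemma indep_set_reversal:
  assumes "indep_set S"
  shows "indep_set (reversal G T ` S)"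
  unfolding independent_glides_def pairwise_def
proof (intro conjI ballI impI)
  show "reversal G T ` S \<subseteq> glides"
    using assms inv_glide by (auto simp: reversal_def independent_glides_def)
next
  fix x y assume "x \<in> reversal G T ` S" "y \<in> reversal G T ` S" "x \<noteq> y"
  then obtain s t where st: "s \<in> S" "t \<in> S" "s \<noteq> t" "x = reversal G T s" "y = reversal G T t"
    by auto
  have "(s, t) \<in> indep" using indep_setD[OF assms] st by auto
  then show "(x, y) \<in> indep"
    using st(4,5) indep_inv indep_sym by (auto simp: reversal_def)
qed

lemma glide_prod_inv_image:
  assumes "finite S" "indep_set S"
  shows "glide_prod G (m_inv G ` S) = inv (glide_prod G S)"
  using assms
proof (induction S rule: finite_induct)
  case empty
  then show ?case by simp
next
  case (insert x F)
  have i: "indep_set F" using indep_set_subset[OF insert.prems] by blast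
  have x: "x \<in> glides" "x \<in> carrier G"
    using insert.prems glide_carrier by (auto simp: independent_glides_def)
  have img: "m_inv G ` insert x F = reversal G (insert x F) ` insert x F"
    by (auto simp: reversal_def)
  have "inv x \<notin> m_inv G ` F"
    using insert.hyps inv_inj indep_set_carrier[OF insert.prems]
    by (metis (no_types, lifting) inj_on_image_mem_iff insert_subset)
  then have "glide_prod G (m_inv G ` insert x F) = inv x \<otimes> glide_prod G (m_inv G ` F)"
    using glide_prod_insert[of "m_inv G ` F" "inv x"] insert.hyps
      indep_set_reversal[OF insert.prems, of "insert x F"] img by simp
  also have "\<dots> = inv (glide_prod G F \<otimes> x)"
    using insert i x by (simp add: inv_mult_group)
  also have "glide_prod G F \<otimes> x = glide_prod G (insert x F)"
    using glide_prod_Un_disjoint[of F "{x}"] insert x by (simp add: glide_prod_singleton)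
  finally show ?case .
qed

text \<open>
  The glides in \<open>R \<inter> T\<close> are traversed forth and back and cancel.
\<close>

lemma glide_prod_reversal:
  assumes "finite S" "indep_set S" "T \<subseteq> S" "R \<subseteq> S"
  shows "glide_prod G (reversal G T ` R) \<otimes> glide_prod G T = glide_prod G (sym_diff R T)"
proof -
  have fin: "finite U" if "U \<subseteq> S" for U using that assms(1) finite_subset by auto
  have ind: "indep_set U" if "U \<subseteq> S" for U using that assms(2) indep_set_subset by auto
  have cl: "glide_prod G U \<in> carrier G" if "U \<subseteq> S" for U using fin ind that by simp
  have Un: "glide_prod G (U \<union> V) = glide_prod G U \<otimes> glide_prod G V"
    if "U \<subseteq> S" "V \<subseteq> S" "U \<inter> V = {}" for U V
    using glide_prod_Un_disjoint[of U V] fin ind that by simp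
  have split: "reversal G T ` R = (R - T) \<union> m_inv G ` (R \<inter> T)"
    by (auto simp: reversal_def)
  have "reversal G T ` (R - T) \<inter> reversal G T ` (R \<inter> T) = {}"
    using inj_on_image_Int[OF reversal_inj_on[OF assms(2), of T], of "R - T" "R \<inter> T"] assms(4)
    by (auto simp: Diff_Int_distrib2)
  moreover have "reversal G T ` (R - T) = R - T" "reversal G T ` (R \<inter> T) = m_inv G ` (R \<inter> T)"
    by (auto simp: reversal_def)
  ultimately have disj: "(R - T) \<inter> m_inv G ` (R \<inter> T) = {}" by simp
  have "indep_set (reversal G T ` R)" using indep_set_reversal ind assms(4) by auto
  then have "glide_prod G (reversal G T ` R)
      = glide_prod G (R - T) \<otimes> glide_prod G (m_inv G ` (R \<inter> T))"
    using glide_prod_Un_disjoint[of "R - T" "m_inv G ` (R \<inter> T)"] disj fin assms(4)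
    unfolding split by (simp add: finite_Int)
  also have "\<dots> = glide_prod G (R - T) \<otimes> inv (glide_prod G (R \<inter> T))"
    using glide_prod_inv_image[OF fin ind, of "R \<inter> T"] assms(4) by (simp add: le_infI1)
  finally have 1: "glide_prod G (reversal G T ` R)
      = glide_prod G (R - T) \<otimes> inv (glide_prod G (R \<inter> T))" .
  have "T = (R \<inter> T) \<union> (T - R)" by auto
  then have "glide_prod G T = glide_prod G (R \<inter> T) \<otimes> glide_prod G (T - R)"
    using Un[of "R \<inter> T" "T - R"] assms(3,4) by auto
  then have "glide_prod G (reversal G T ` R) \<otimes> glide_prod G T
      = glide_prod G (R - T) \<otimes> inv (glide_prod G (R \<inter> T)) \<otimes> (glide_prod G (R \<inter> T) \<otimes> glide_prod G (T - R))"
    using 1 by simp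
  also have "\<dots> = glide_prod G (R - T) \<otimes> glide_prod G (T - R)"
  proof -
    have c: "glide_prod G (R - T) \<in> carrier G" "glide_prod G (R \<inter> T) \<in> carrier G"
      "glide_prod G (T - R) \<in> carrier G"
      using cl assms(3,4) by (meson Diff_subset inf.coboundedI1 order_trans)+
    have "inv (glide_prod G (R \<inter> T)) \<otimes> (glide_prod G (R \<inter> T) \<otimes> glide_prod G (T - R))
        = glide_prod G (T - R)"
      using c by (simp add: m_assoc[symmetric])
    then show ?thesis using c by (simp add: m_assoc)
  qed
  also have "\<dots> = glide_prod G (sym_diff R T)"
    by (rule Un[symmetric]) (use assms(3,4) in blast)+
  finally show ?thesis .
qed

section \<open>Cubic sets and based cubes\<close>

lemma cubicD:
  assumes "cubic_set S"
  shows "finite S" "indep_set S" "inj_on (glide_prod G) (Pow S)"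
  using assms by (auto simp: cubic_def)

lemma cubic_subset: "cubic_set S \<Longrightarrow> T \<subseteq> S \<Longrightarrow> cubic_set T"
  unfolding cubic_def by (meson Pow_mono finite_subset indep_set_subset inj_on_subset)

lemma cubic_empty: "cubic_set {}"
  by (simp add: cubic_def independent_glides_def)

lemma cubic_prod_closed: "cubic_set S \<Longrightarrow> T \<subseteq> S \<Longrightarrow> glide_prod G T \<in> carrier G"
  by (meson cubicD(1,2) cubic_subset glide_prod_closed)

text \<open>
  A based cube has as many vertices as subsets of its axes, so a vertex determines the set of axes
  that lead to it.
\<close>

lemma cubic_prod_eqD:
  assumes "cubic_set S" "T \<subseteq> S" "R \<subseteq> S" "A \<in> carrier G"
    and "glide_prod G T \<otimes> A = glide_prod G R \<otimes> A"
  shows "T = R"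
proof -
  have "glide_prod G T = glide_prod G R"
    using assms cubic_prod_closed by (metis right_cancel)
  then show ?thesis using cubicD(3)[OF assms(1)] assms(2,3) by (auto dest: inj_onD)
qed

lemma cubic_reversal_prod:
  assumes "cubic_set S" "T \<subseteq> S" "R \<subseteq> S" "A \<in> carrier G"
  shows "glide_prod G (reversal G T ` R) \<otimes> (glide_prod G T \<otimes> A) = glide_prod G (sym_diff R T) \<otimes> A"
proof -
  have "indep_set (reversal G T ` R)" "finite (reversal G T ` R)"
    using indep_set_reversal cubicD[OF cubic_subset[OF assms(1,3)]] by auto
  then have "glide_prod G (reversal G T ` R) \<in> carrier G" by simp
  then show ?thesis
    using glide_prod_reversal[OF cubicD(1,2)[OF assms(1)] assms(2,3)] assms
    by (simp add: m_assoc[symmetric] cubic_prod_closed)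
qed

text \<open>
  The vertices of the flipped cube are those of the original cube, relabelled by the symmetric
  difference with \<open>T\<close>, and relabelling keeps them distinct.
\<close>

lemma cubic_reversal:
  assumes "cubic_set S" "T \<subseteq> S"
  shows "cubic_set (reversal G T ` S)"
  unfolding cubic_def
proof (intro conjI inj_onI)
  show "finite (reversal G T ` S)" "indep_set (reversal G T ` S)"
    using cubicD[OF assms(1)] indep_set_reversal by auto
  fix U V assume U: "U \<in> Pow (reversal G T ` S)" and V: "V \<in> Pow (reversal G T ` S)"
    and eq: "glide_prod G U = glide_prod G V"
  obtain R where R: "R \<subseteq> S" "U = reversal G T ` R" using U by (metis PowD subset_imageE)
  obtain R' where R': "R' \<subseteq> S" "V = reversal G T ` R'" using V by (metis PowD subset_imageE)
  have "glide_prod G (sym_diff R T) \<otimes> \<one> = glide_prod G (sym_diff R' T) \<otimes> \<one>"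
    using eq cubic_reversal_prod[OF assms R(1) one_closed]
      cubic_reversal_prod[OF assms R'(1) one_closed] by (simp only: R(2) R'(2))
  then have "sym_diff R T = sym_diff R' T"
    by (rule cubic_prod_eqD[OF assms(1) _ _ one_closed, rotated 2]) (use R(1) R'(1) assms(2) in blast)+
  then have "R = R'" by blast
  then show "U = V" using R(2) R'(2) by simp
qed

lemma cubic_singleton:
  assumes "s \<in> glides" shows "cubic_set {s}"
proof -
  have "s \<noteq> \<one>" using assms glides_subset by auto
  then show ?thesis
    using assms by (auto simp: cubic_def independent_glides_def Pow_insert inj_on_def
        glide_prod_singleton)
qed

text \<open>
  A coincidence \<open>s \<otimes> t = \<one>\<close> would make \<open>inv s\<close> independent of itself, and the other coincidences
  contradict that glides are nontrivial and that \<open>s\<close> and \<open>t\<close> are distinct.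
\<close>

lemma cubic_pair:
  assumes "(s, t) \<in> indep" shows "cubic_set {s, t}"
proof -
  note p = glide_prod_pair[OF assms]
  have g: "s \<in> glides" "t \<in> glides" "s \<in> carrier G" "t \<in> carrier G" "s \<noteq> \<one>" "t \<noteq> \<one>"
    using assms indep_subset glides_subset by auto
  have "s \<otimes> t \<noteq> \<one>"
  proof
    assume "s \<otimes> t = \<one>"
    then have "inv s = t" using indep_commute[OF assms] g by (intro inv_equality) auto
    then show False using indep_inv[OF assms] indep_irrefl g by auto
  qed
  moreover have "s \<otimes> t \<noteq> s" "s \<otimes> t \<noteq> t" using g by auto
  ultimately have "distinct [\<one>, s, t, s \<otimes> t]" using p(1) g by simp
  then have "distinct (map (glide_prod G) [{}, {s}, {t}, {s, t}])"
    using p(3) g(1,2) by (simp only: list.map glide_prod_empty glide_prod_singleton)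
  then have "inj_on (glide_prod G) {{}, {s}, {t}, {s, t}}"
    unfolding distinct_map list.set by blast
  moreover have "Pow {s, t} = {{}, {s}, {t}, {s, t}}" by (auto simp: Pow_insert)
  ultimately show ?thesis using p(2) by (simp add: cubic_def)
qed

end

section \<open>Points of the glued complex\<close>

text \<open>
  The coordinate along the axis \<open>s\<close> of a point of a cube, measured from the vertex reached through
  the axes in \<open>T\<close>.
\<close>

definition reflect :: "'a set \<Rightarrow> ('a \<Rightarrow> real) \<Rightarrow> 'a \<Rightarrow> real" where
  "reflect T x s = (if s \<in> T then 1 - x s else x s)"

text \<open>
  All descriptions of a point of the complex from the vertices \<open>A\<close> of the given cube for which every
  coordinate measured from \<open>A\<close> is less than \<open>1\<close>.  A description is a coordinate function on the
  whole group, zero off the axes of the cube.  A vertex outside the smallest face containing the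
  point sees some coordinate equal to \<open>1\<close>, so it contributes no view, and the extension by zero
  makes the remaining views the same for a face and for the larger cube.  Hence this set depends on
  the glued point only.
\<close>

definition views ::
  "('a, 'b) monoid_scheme \<Rightarrow> 'a \<times> 'a set \<times> ('a \<Rightarrow> real) \<Rightarrow> ('a \<times> ('a \<Rightarrow> real)) set" where
  "views G = (\<lambda>(B, S, x). {(A, u). \<exists>T \<subseteq> S. A = glide_prod G T \<otimes>\<^bsub>G\<^esub> B
     \<and> (\<forall>s \<in> S. reflect T x s < 1 \<and> u (reversal G T s) = reflect T x s)
     \<and> (\<forall>g. g \<notin> reversal G T ` S \<longrightarrow> u g = 0)})"

definition zero_extension :: "'a set \<Rightarrow> ('a \<Rightarrow> real) \<Rightarrow> 'a \<Rightarrow> real" where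
  "zero_extension S y g = (if g \<in> S then y g else 0)"

lemma mem_views:
  "(A, u) \<in> views G (B, S, x) \<longleftrightarrow> (\<exists>T \<subseteq> S. A = glide_prod G T \<otimes>\<^bsub>G\<^esub> B
     \<and> (\<forall>s \<in> S. reflect T x s < 1 \<and> u (reversal G T s) = reflect T x s)
     \<and> (\<forall>g. g \<notin> reversal G T ` S \<longrightarrow> u g = 0))"
  by (simp add: views_def)

lemma complex_point_eq_iff:
  "complex_point G glides indep q = complex_point G glides indep r
     \<longleftrightarrow> equivclp (glue G glides indep) q r"
proof
  assume "complex_point G glides indep q = complex_point G glides indep r"
  moreover have "r \<in> complex_point G glides indep r" by (simp add: complex_point_def)
  ultimately have "r \<in> complex_point G glides indep q" by simp
  then show "equivclp (glue G glides indep) q r" by (simp add: complex_point_def)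
next
  assume qr: "equivclp (glue G glides indep) q r"
  show "complex_point G glides indep q = complex_point G glides indep r"
    unfolding complex_point_def
    using equivclp_trans[OF qr] equivclp_trans[OF equivclp_sym[OF qr]] by blast
qed

lemma glue_imp_complex_point_eq:
  "glue G glides indep q r \<Longrightarrow> complex_point G glides indep q = complex_point G glides indep r"
  by (simp add: complex_point_eq_iff r_into_equivclp)

context gliding_system
begin

abbreviation "point \<equiv> complex_point G glides indep"

text \<open>
  The axes in \<open>S' - S\<close> have coordinate \<open>0\<close>.  Reversing such an axis would produce the coordinate
  \<open>1\<close>, so every view uses a set \<open>T\<close> of axes of the smaller cube.
\<close>

lemma views_face:
  assumes "indep_set S'" "S \<subseteq> S'" "\<And>s. s \<in> S \<Longrightarrow> x s = x' s" "\<And>s. s \<in> S' - S \<Longrightarrow> x' s = 0"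
  shows "views G (A, S, x) = views G (A, S', x')"
proof (intro equalityI subsetI)
  fix p assume "p \<in> views G (A, S, x)"
  then obtain B u T where p: "p = (B, u)" and T: "T \<subseteq> S" "B = glide_prod G T \<otimes> A"
    "\<forall>s \<in> S. reflect T x s < 1 \<and> u (reversal G T s) = reflect T x s"
    "\<forall>g. g \<notin> reversal G T ` S \<longrightarrow> u g = 0"
    by (cases p) (auto simp: mem_views)
  have new: "reflect T x' s < 1 \<and> u (reversal G T s) = reflect T x' s" if s: "s \<in> S' - S" for s
  proof -
    have "reversal G T s \<notin> reversal G T ` S"
      using inj_on_image_mem_iff[OF reversal_inj_on[OF assms(1), of T]] s assms(2) by auto
    then show ?thesis using T s assms(4)[OF s] by (auto simp: reflect_def)
  qed
  have old: "reflect T x' s = reflect T x s" if "s \<in> S" for s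
    using assms(3)[OF that] by (simp add: reflect_def)
  show "p \<in> views G (A, S', x')"
    unfolding p mem_views
  proof (intro exI[of _ T] conjI ballI allI impI)
    show "T \<subseteq> S'" using T assms(2) by blast
    show "B = glide_prod G T \<otimes> A" by fact
  next
    fix s assume "s \<in> S'"
    then show "reflect T x' s < 1" "u (reversal G T s) = reflect T x' s"
      using new old T(3) by (metis DiffI)+
  next
    fix g assume "g \<notin> reversal G T ` S'"
    then show "u g = 0" using T(4) assms(2) by blast
  qed
next
  fix p assume "p \<in> views G (A, S', x')"
  then obtain B u T where p: "p = (B, u)" and T: "T \<subseteq> S'" "B = glide_prod G T \<otimes> A"
    "\<forall>s \<in> S'. reflect T x' s < 1 \<and> u (reversal G T s) = reflect T x' s"
    "\<forall>g. g \<notin> reversal G T ` S' \<longrightarrow> u g = 0"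
    by (cases p) (auto simp: mem_views)
  have TS: "T \<subseteq> S"
  proof
    fix s assume s: "s \<in> T"
    show "s \<in> S"
    proof (rule ccontr)
      assume "s \<notin> S"
      then have "reflect T x' s = 1" using s T(1) assms(4)[of s] by (auto simp: reflect_def)
      then show False using T(1,3) s by force
    qed
  qed
  have old: "reflect T x' s = reflect T x s" if "s \<in> S" for s
    using assms(3)[OF that] by (simp add: reflect_def)
  show "p \<in> views G (A, S, x)"
    unfolding p mem_views
  proof (intro exI[of _ T] conjI ballI allI impI)
    show "T \<subseteq> S" "B = glide_prod G T \<otimes> A" by fact+
  next
    fix s assume "s \<in> S"
    then show "reflect T x s < 1" "u (reversal G T s) = reflect T x s"
      using old[of s] T(3) assms(2) by (metis subsetD)+
  next
    fix g assume g: "g \<notin> reversal G T ` S"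
    show "u g = 0"
    proof (cases "g \<in> reversal G T ` S'")
      case True
      then obtain s where s: "s \<in> S' - S" "g = reversal G T s" using g by auto
      then have "u g = reflect T x' s" using T(3) by auto
      also have "\<dots> = 0" using s TS assms(4)[of s] by (auto simp: reflect_def)
      finally show ?thesis .
    qed (use T(4) in auto)
  qed
qed

text \<open>
  The change of base vertex permutes the vertices of the cube by \<open>R \<mapsto> sym_diff R T\<close> and does
  not change what is seen from each of them.
\<close>

lemma views_flip:
  assumes "cubic_set S" "T \<subseteq> S" "B \<in> carrier G"
    and x': "\<And>s. s \<in> S \<Longrightarrow> x' (reversal G T s) = reflect T x s"
  shows "views G (glide_prod G T \<otimes> B, reversal G T ` S, x') = views G (B, S, x)"
proof -
  let ?S' = "reversal G T ` S"
  define Q where "Q = (\<lambda>A u R. A = glide_prod G R \<otimes> B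
     \<and> (\<forall>s \<in> S. reflect R x s < 1 \<and> u (reversal G R s) = reflect R x s)
     \<and> (\<forall>g. g \<notin> reversal G R ` S \<longrightarrow> u g = (0::real)))"
  define Q' where "Q' = (\<lambda>A u R. A = glide_prod G R \<otimes> (glide_prod G T \<otimes> B)
     \<and> (\<forall>s \<in> ?S'. reflect R x' s < 1 \<and> u (reversal G R s) = reflect R x' s)
     \<and> (\<forall>g. g \<notin> reversal G R ` ?S' \<longrightarrow> u g = (0::real)))"
  have QQ: "Q' A u (reversal G T ` R) \<longleftrightarrow> Q A u (sym_diff R T)" if R: "R \<subseteq> S" for A u R
  proof -
    have 1: "reflect (reversal G T ` R) x' (reversal G T s) = reflect (sym_diff R T) x s"
      if s: "s \<in> S" for s
    proof -
      have "reversal G T s \<in> reversal G T ` R \<longleftrightarrow> s \<in> R"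
        using inj_on_image_mem_iff[OF reversal_inj_on[OF cubicD(2)[OF assms(1)]] s R] .
      then show ?thesis using x'[OF s] by (auto simp: reflect_def)
    qed
    have 2: "reversal G (reversal G T ` R) (reversal G T s) = reversal G (sym_diff R T) s"
      if s: "s \<in> S" for s
      by (rule reversal_reversal[OF cubicD(2)[OF assms(1)] assms(2) R s])
    have 3: "reversal G (reversal G T ` R) ` ?S' = reversal G (sym_diff R T) ` S"
      unfolding image_image by (rule image_cong) (simp_all only: 2)
    show ?thesis
      unfolding Q_def Q'_def 3 cubic_reversal_prod[OF assms(1,2) R assms(3)] ball_simps
      by (simp only: 1 2 cong: ball_cong)
  qed
  have "(\<exists>R' \<subseteq> ?S'. Q' A u R') \<longleftrightarrow> (\<exists>R \<subseteq> S. Q A u R)" for A u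
  proof
    assume "\<exists>R' \<subseteq> ?S'. Q' A u R'"
    then obtain R where R: "R \<subseteq> S" "Q' A u (reversal G T ` R)" by (auto simp: subset_image_iff)
    then have "Q A u (sym_diff R T)" using QQ by simp
    moreover have "sym_diff R T \<subseteq> S" using R(1) assms(2) by blast
    ultimately show "\<exists>R \<subseteq> S. Q A u R" by blast
  next
    assume "\<exists>R \<subseteq> S. Q A u R"
    then obtain R where R: "R \<subseteq> S" "Q A u R" by auto
    have "sym_diff (sym_diff R T) T = R" "sym_diff R T \<subseteq> S" using R(1) assms(2) by blast+
    then have "Q' A u (reversal G T ` sym_diff R T)" using QQ[of "sym_diff R T"] R(2) by simp
    moreover have "reversal G T ` sym_diff R T \<subseteq> ?S'"
      using \<open>sym_diff R T \<subseteq> S\<close> by (rule image_mono)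
    ultimately show "\<exists>R' \<subseteq> ?S'. Q' A u R'" by blast
  qed
  then show ?thesis
    unfolding Q_def Q'_def by (simp only: views_def prod.case)
qed

lemma glue_imp_views_eq:
  assumes "glue G glides indep q r"
  shows "views G q = views G r"
  using assms
proof cases
  case (glue_face A S S' x x')
  then show ?thesis
    using views_face[of S' S x x' A] by (auto simp: based_cubes_def cubic_def)
next
  case (glue_flip A S T x x')
  have c: "cubic_set S" "A \<in> carrier G" using glue_flip by (auto simp: based_cubes_def)
  have "x' (reversal G T s) = reflect T x s" if "s \<in> S" for s
    using glue_flip that by (auto simp: reversal_def reflect_def)
  then have "views G (glide_prod G T \<otimes> A, reversal G T ` S, x') = views G (A, S, x)"
    using views_flip c glue_flip by blast
  then show ?thesis using glue_flip by (simp add: flip_eq_image)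
qed

lemma point_eq_imp_views_eq:
  assumes "point q = point r"
  shows "views G q = views G r"
  using assms[unfolded complex_point_eq_iff]
  by (induction rule: equivclp_induct) (auto dest: glue_imp_views_eq)

lemma own_view:
  assumes "B \<in> carrier G" "\<forall>s \<in> S. y s < 1"
  shows "(B, zero_extension S y) \<in> views G (B, S, y)"
  unfolding mem_views
  by (rule exI[of _ "{}"]) (use assms in \<open>auto simp: reflect_def reversal_def zero_extension_def\<close>)

text \<open>
  A view from the base vertex itself must use \<open>T = {}\<close>, because the vertices of a cubic set
  are distinct.
\<close>

lemma own_view_unique:
  assumes "B \<in> carrier G" "cubic_set S" "(B, u) \<in> views G (B, S, y)"
  shows "u = zero_extension S y"
proof -
  obtain T where T: "T \<subseteq> S" "B = glide_prod G T \<otimes> B"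
    "\<forall>s \<in> S. reflect T y s < 1 \<and> u (reversal G T s) = reflect T y s"
    "\<forall>g. g \<notin> reversal G T ` S \<longrightarrow> u g = 0"
    using assms(3) by (auto simp: mem_views)
  have "T = {}"
    by (rule cubic_prod_eqD[OF assms(2) T(1) _ assms(1)]) (use T(2) assms(1) in auto)
  then show ?thesis
    using T by (auto simp: zero_extension_def reflect_def reversal_def fun_eq_iff image_iff)
qed

lemma point_face:
  assumes "A \<in> carrier G" "cubic_set S" "y \<in> S \<rightarrow>\<^sub>E {0..1}" "P \<subseteq> S" "\<forall>s \<in> S - P. y s = 0"
  shows "point (A, P, restrict y P) = point (A, S, y)"
proof (rule glue_imp_complex_point_eq, rule glue_face)
  show "(A, P) \<in> based_cubes G glides indep" "(A, S) \<in> based_cubes G glides indep"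
    using assms cubic_subset by (auto simp: based_cubes_def)
  show "restrict y P \<in> P \<rightarrow>\<^sub>E {0..1}" using assms(3,4) by (auto simp: PiE_iff)
qed (use assms in auto)

text \<open>
  If the points agree, so do their views from the common base vertex \<open>A\<close>, and each point has only one
  view from \<open>A\<close>.  Conversely, both points lie in the face spanned by the axes with nonzero
  coordinate.
\<close>

lemma point_eq_iff:
  assumes A: "A \<in> carrier G" and S: "cubic_set S" "cubic_set S'"
    and y: "y \<in> S \<rightarrow>\<^sub>E {0..<1}" "y' \<in> S' \<rightarrow>\<^sub>E {0..<1}"
  shows "point (A, S, y) = point (A, S', y') \<longleftrightarrow> zero_extension S y = zero_extension S' y'"
proof
  assume "point (A, S, y) = point (A, S', y')"
  then have "views G (A, S, y) = views G (A, S', y')" by (rule point_eq_imp_views_eq)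
  moreover have "(A, zero_extension S y) \<in> views G (A, S, y)"
    using own_view[OF A] y(1) by (auto simp: PiE_iff)
  ultimately show "zero_extension S y = zero_extension S' y'"
    using own_view_unique[OF A S(2)] by simp
next
  assume eq: "zero_extension S y = zero_extension S' y'"
  define P where "P = {s. zero_extension S y s \<noteq> 0}"
  have P': "P = {s. zero_extension S' y' s \<noteq> 0}" unfolding P_def eq ..
  have P: "P \<subseteq> S" unfolding P_def by (auto simp: zero_extension_def)
  have Q: "P \<subseteq> S'" unfolding P' by (auto simp: zero_extension_def)
  have y0: "\<forall>s \<in> S - P. y s = 0"
    unfolding P_def by (auto simp: zero_extension_def)
  have y0': "\<forall>s \<in> S' - P. y' s = 0"
    unfolding P' by (auto simp: zero_extension_def)
  have "restrict y P = restrict y' P"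
  proof
    fix s
    show "restrict y P s = restrict y' P s"
      using P Q fun_cong[OF eq, of s]
      by (auto simp: zero_extension_def subset_iff split: if_splits)
  qed
  moreover have "y \<in> S \<rightarrow>\<^sub>E {0..1}" "y' \<in> S' \<rightarrow>\<^sub>E {0..1}"
    using y by (auto simp: PiE_iff less_imp_le)
  ultimately show "point (A, S, y) = point (A, S', y')"
    using point_face[OF A S(1) _ P y0] point_face[OF A S(2) _ Q y0'] by simp
qed

lemma point_flip:
  assumes "B \<in> carrier G" "cubic_set S" "T \<subseteq> S" "x \<in> S \<rightarrow>\<^sub>E {0..1}"
    "x' \<in> reversal G T ` S \<rightarrow>\<^sub>E {0..1}" "\<And>s. s \<in> S \<Longrightarrow> x' (reversal G T s) = reflect T x s"
  shows "point (B, S, x) = point (glide_prod G T \<otimes> B, reversal G T ` S, x')"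
proof -
  have "x' s = x s" if "s \<in> S - T" for s
    using assms(6)[of s] that by (simp add: reversal_def reflect_def)
  moreover have "x' (inv s) = 1 - x s" if "s \<in> T" for s
    using assms(3) assms(6)[of s] that by (auto simp: reversal_def reflect_def)
  ultimately have "glue G glides indep (B, S, x) (glide_prod G T \<otimes> B, flip G S T, x')"
    using assms by (intro glue.glue_flip) (auto simp: based_cubes_def flip_eq_image)
  then show ?thesis
    using assms(3) by (simp add: glue_imp_complex_point_eq flip_eq_image)
qed

text \<open>
  Flipping the axes with coordinate \<open>1\<close> gives a based cube at the corner, with all coordinates zero.
\<close>

lemma point_corner_iff:
  assumes "B \<in> carrier G" "A \<in> carrier G" "cubic_set S" "a \<in> S \<rightarrow>\<^sub>E {0, 1}"
  shows "point (B, S, a) = point (A, {}, \<lambda>_. undefined)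
    \<longleftrightarrow> A = glide_prod G {s \<in> S. a s = 1} \<otimes> B"
proof -
  define T where "T = {s \<in> S. a s = 1}"
  define C where "C = glide_prod G T \<otimes> B"
  have T: "T \<subseteq> S" by (auto simp: T_def)
  have C: "C \<in> carrier G" using cubic_prod_closed[OF assms(3) T] assms(1) by (simp add: C_def)
  have S': "cubic_set (reversal G T ` S)" by (rule cubic_reversal[OF assms(3) T])
  have a: "a s = (if s \<in> T then 1 else 0)" if "s \<in> S" for s
    using assms(4) that by (auto simp: T_def PiE_iff)
  let ?z = "\<lambda>s \<in> reversal G T ` S. 0::real"
  have "point (B, S, a) = point (C, reversal G T ` S, ?z)"
    unfolding C_def
    by (rule point_flip[OF assms(1,3) T]) (use assms(4) in \<open>auto simp: a reflect_def PiE_iff\<close>)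
  also have "\<dots> = point (C, {}, restrict ?z {})"
    by (rule point_face[OF C S', symmetric]) (auto simp: PiE_iff)
  also have "restrict ?z {} = (\<lambda>_. undefined)" by auto
  finally have 1: "point (B, S, a) = point (C, {}, \<lambda>_. undefined)" .
  have "A = C" if "point (C, {}, \<lambda>_. undefined) = point (A, {}, \<lambda>_. undefined)"
  proof -
    have "(A, zero_extension {} (\<lambda>_. undefined)) \<in> views G (C, {}, \<lambda>_. undefined)"
      using point_eq_imp_views_eq[OF that] own_view[OF assms(2)] by auto
    then show ?thesis using C by (auto simp: mem_views)
  qed
  then show ?thesis using 1 unfolding T_def[symmetric] C_def[symmetric] by auto
qed

end

section \<open>Links of the glide complex\<close>

lemma std_simplexD:
  assumes "v \<in> std_simplex J"
  shows "\<And>i. i \<in> J \<Longrightarrow> 0 \<le> v i" "sum v J = 1" "v \<in> extensional J"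
  using assms by (auto simp: std_simplex_def PiE_iff)

lemma std_simplex_le_1:
  assumes "finite J" "v \<in> std_simplex J" "i \<in> J"
  shows "v i \<le> 1"
  using member_le_sum[of i J v] std_simplexD[OF assms(2)] assms by auto

definition barycentric :: "'a set \<Rightarrow> ('a \<Rightarrow> real) set" where
  "barycentric S = {u. (\<forall>g. 0 \<le> u g) \<and> (\<forall>g. g \<notin> S \<longrightarrow> u g = 0) \<and> sum u S = 1}"

definition unit_coord :: "'a \<Rightarrow> 'a \<Rightarrow> real" where
  "unit_coord s = (\<lambda>g. if g = s then 1 else 0)"

text \<open>
  Simplices given by barycentric coordinates in a common space of functions automatically intersect
  in common faces; this is what makes all links simplicial.
\<close>

lemma barycentric_Int:
  assumes "finite S" "finite S'"
  shows "barycentric S \<inter> barycentric S' = barycentric (S \<inter> S')"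
proof -
  have "sum u (S \<inter> S') = sum u S" if "\<forall>g. g \<notin> S' \<longrightarrow> u g = 0" for u :: "'a \<Rightarrow> real"
    using assms that by (intro sum.mono_neutral_left) auto
  moreover have "sum u (S \<inter> S') = sum u S'" if "\<forall>g. g \<notin> S \<longrightarrow> u g = 0" for u :: "'a \<Rightarrow> real"
    using assms that by (intro sum.mono_neutral_left) auto
  ultimately show ?thesis
    unfolding barycentric_def by (intro equalityI subsetI) (simp_all, metis+)
qed

lemma unit_coord_barycentric: "finite S \<Longrightarrow> s \<in> S \<Longrightarrow> unit_coord s \<in> barycentric S"
  by (auto simp: barycentric_def unit_coord_def sum.delta)

lemma unit_coord_inj: "unit_coord s = unit_coord t \<longleftrightarrow> s = t"
  by (metis unit_coord_def zero_neq_one)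

locale glide_subset = gliding_system +
  fixes E :: "'a set"
  assumes E_carrier: "E \<subseteq> carrier G"
begin

abbreviation "X \<equiv> glide_complex G glides indep E"
abbreviation "vertex_point A \<equiv> point (A, {}, \<lambda>_. undefined)"

text \<open>
  The nonempty cubic sets that are the axes of a based cube at \<open>A\<close> with all its vertices in \<open>E\<close>.  They
  turn out to be the simplices of the link of \<open>A\<close>, a vertex of the link being a glide \<open>s\<close> with
  \<open>sA\<close> in \<open>E\<close>.
\<close>

definition spanning :: "'a \<Rightarrow> 'a set set" where
  "spanning A = {S. S \<noteq> {} \<and> cubic_set S \<and> (\<forall>T \<subseteq> S. glide_prod G T \<otimes> A \<in> E)}"

lemma cells_X: "cells X = {Q \<in> group_cubes G glides indep. cube_vertices G Q \<subseteq> E}"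
  and axes_X: "axes X Q = snd (cube_rep Q)"
  and char_map_X: "char_map X Q x = point (fst (cube_rep Q), snd (cube_rep Q), x)"
  by (simp_all add: glide_complex_def group_complex_def)

lemma based_cube_rel_iff:
  "((A, S), (B, S')) \<in> based_cube_rel G glides indep \<longleftrightarrow> A \<in> carrier G \<and> cubic_set S
    \<and> (\<exists>T \<subseteq> S. B = glide_prod G T \<otimes> A \<and> S' = reversal G T ` S)"
  by (auto simp: based_cube_rel_def based_cubes_def flip_eq_image)

lemma based_cube_rel_refl:
  assumes "A \<in> carrier G" "cubic_set S"
  shows "((A, S), (A, S)) \<in> based_cube_rel G glides indep"
  unfolding based_cube_rel_iff using assms
  by (intro conjI exI[of _ "{}"]) (auto simp: reversal_def)

lemma cube_rep_in:
  assumes "A \<in> carrier G" "cubic_set S"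
  obtains T where "T \<subseteq> S"
    "cube_rep (based_cube_rel G glides indep `` {(A, S)}) = (glide_prod G T \<otimes> A, reversal G T ` S)"
    "cube_rep (based_cube_rel G glides indep `` {(A, S)}) \<in> based_cube_rel G glides indep `` {(A, S)}"
proof -
  let ?Q = "based_cube_rel G glides indep `` {(A, S)}"
  have "cube_rep ?Q \<in> ?Q"
    unfolding cube_rep_def by (rule someI[of _ "(A, S)"]) (use based_cube_rel_refl assms in auto)
  moreover obtain B S' where "cube_rep ?Q = (B, S')" by fastforce
  ultimately show thesis using that by (auto simp: based_cube_rel_iff)
qed

text \<open>
  The chosen representative of a cell may be based at any vertex of the cube, so its vertices have to
  be matched with those of the based cube from which the cell was formed.
\<close>

lemma cell_rep:
  assumes "Q \<in> cells X"
  obtains B S where "cube_rep Q = (B, S)" "B \<in> carrier G" "cubic_set S"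
    "\<And>T. T \<subseteq> S \<Longrightarrow> glide_prod G T \<otimes> B \<in> E"
proof -
  obtain A S where A: "A \<in> carrier G" "cubic_set S"
    and Q: "Q = based_cube_rel G glides indep `` {(A, S)}"
    using assms by (auto simp: cells_X group_cubes_def based_cubes_def elim!: quotientE)
  obtain T where T: "T \<subseteq> S" "cube_rep Q = (glide_prod G T \<otimes> A, reversal G T ` S)" "cube_rep Q \<in> Q"
    using cube_rep_in[OF A] Q by metis
  show thesis
  proof
    show "cube_rep Q = (glide_prod G T \<otimes> A, reversal G T ` S)" by fact
    show "glide_prod G T \<otimes> A \<in> carrier G" using A T cubic_prod_closed by auto
    show "cubic_set (reversal G T ` S)" using A T cubic_reversal by auto
    fix R assume "R \<subseteq> reversal G T ` S"
    then have "glide_prod G R \<otimes> (glide_prod G T \<otimes> A) \<in> cube_vertices G Q"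
      unfolding cube_vertices_def using T by auto
    then show "glide_prod G R \<otimes> (glide_prod G T \<otimes> A) \<in> E" using assms by (auto simp: cells_X)
  qed
qed

lemma cell_exists:
  assumes "A \<in> carrier G" "cubic_set S" "\<And>T. T \<subseteq> S \<Longrightarrow> glide_prod G T \<otimes> A \<in> E"
  obtains Q T where "Q \<in> cells X" "T \<subseteq> S" "cube_rep Q = (glide_prod G T \<otimes> A, reversal G T ` S)"
proof -
  define Q where "Q = based_cube_rel G glides indep `` {(A, S)}"
  have "Q \<in> group_cubes G glides indep"
    unfolding Q_def group_cubes_def using assms by (auto intro!: quotientI simp: based_cubes_def)
  moreover have "cube_vertices G Q \<subseteq> E"
  proof
    fix B assume "B \<in> cube_vertices G Q"
    then obtain T R where T: "T \<subseteq> S" "R \<subseteq> reversal G T ` S"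
      "B = glide_prod G R \<otimes> (glide_prod G T \<otimes> A)"
      by (auto simp: cube_vertices_def Q_def based_cube_rel_iff)
    obtain U where U: "U \<subseteq> S" "R = reversal G T ` U" using T(2) by (auto simp: subset_image_iff)
    have "B = glide_prod G (sym_diff U T) \<otimes> A"
      unfolding T(3) U(2) by (rule cubic_reversal_prod[OF assms(2) T(1) U(1) assms(1)])
    moreover have "sym_diff U T \<subseteq> S" using T(1) U(1) by blast
    ultimately show "B \<in> E" using assms(3) by simp
  qed
  ultimately have "Q \<in> cells X" by (simp add: cells_X)
  moreover obtain T where "T \<subseteq> S" "cube_rep Q = (glide_prod G T \<otimes> A, reversal G T ` S)"
    using cube_rep_in[OF assms(1,2)] unfolding Q_def by metis
  ultimately show thesis using that by blast
qed

lemma zero_cells_X: "zero_cells X = vertex_point ` E"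
proof (intro equalityI subsetI)
  fix p assume "p \<in> zero_cells X"
  then obtain Q where Q: "Q \<in> cells X" "axes X Q = {}" "p = char_map X Q (\<lambda>_. undefined)"
    by (auto simp: zero_cells_def)
  obtain B S where B: "cube_rep Q = (B, S)" "B \<in> carrier G"
    "\<And>T. T \<subseteq> S \<Longrightarrow> glide_prod G T \<otimes> B \<in> E"
    using cell_rep[OF Q(1)] by metis
  have "S = {}" using Q(2) B(1) by (simp add: axes_X)
  moreover have "B \<in> E" using B(3)[of "{}"] B(2) by simp
  ultimately show "p \<in> vertex_point ` E" using Q(3) B(1) by (simp add: char_map_X)
next
  fix p assume "p \<in> vertex_point ` E"
  then obtain A where A: "A \<in> E" "A \<in> carrier G" "p = vertex_point A" using E_carrier by auto
  then obtain Q T where "Q \<in> cells X" "T \<subseteq> {}" "cube_rep Q = (glide_prod G T \<otimes> A, reversal G T ` {})"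
    using cell_exists[of A "{}"] cubic_empty by auto
  then show "p \<in> zero_cells X"
    using A by (auto simp: zero_cells_def axes_X char_map_X intro!: exI[of _ Q])
qed

text \<open>
  A corner \<open>(Q, a)\<close> singles out the representative of \<open>Q\<close> based at the vertex \<open>a\<close>.  The map
  \<open>turn\<close> takes the axes of the cell to the glides that leave this vertex along them, and
  \<open>bary\<close> expresses a direction in terms of these glides.
\<close>

definition turn where
  "turn \<sigma> = reversal G {i \<in> axes X (fst \<sigma>). snd \<sigma> i = (1::real)}"

definition glides_at where
  "glides_at \<sigma> = turn \<sigma> ` axes X (fst \<sigma>)"

definition bary :: "('a \<times> 'a set) set \<times> ('a \<Rightarrow> real) \<Rightarrow> ('a \<Rightarrow> real) \<Rightarrow> 'a \<Rightarrow> real" where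
  "bary \<sigma> v = zero_extension (glides_at \<sigma>) (\<lambda>g. v (inv_into (axes X (fst \<sigma>)) (turn \<sigma>) g))"

lemma cornerE:
  assumes "\<sigma> \<in> corners X (vertex_point A)" "A \<in> E"
  obtains Q a B S where "\<sigma> = (Q, a)" "Q \<in> cells X" "cube_rep Q = (B, S)" "axes X (fst \<sigma>) = S"
    "S \<noteq> {}" "B \<in> carrier G" "cubic_set S" "a \<in> S \<rightarrow>\<^sub>E {0, 1}"
    "\<And>T. T \<subseteq> S \<Longrightarrow> glide_prod G T \<otimes> B \<in> E"
    "A = glide_prod G {i \<in> S. a i = 1} \<otimes> B" "turn \<sigma> = reversal G {i \<in> S. a i = 1}"
    "glides_at \<sigma> = reversal G {i \<in> S. a i = 1} ` S"
proof -
  obtain Q a where \<sigma>: "\<sigma> = (Q, a)" "Q \<in> cells X" "axes X Q \<noteq> {}" "a \<in> axes X Q \<rightarrow>\<^sub>E {0, 1}"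
    "char_map X Q a = vertex_point A"
    using assms(1) by (auto simp: corners_def)
  obtain B S where B: "cube_rep Q = (B, S)" "B \<in> carrier G" "cubic_set S"
    "\<And>T. T \<subseteq> S \<Longrightarrow> glide_prod G T \<otimes> B \<in> E"
    using cell_rep[OF \<sigma>(2)] by metis
  have ax: "axes X Q = S" using B(1) by (simp add: axes_X)
  have a: "a \<in> S \<rightarrow>\<^sub>E {0, 1}" using \<sigma>(4) ax by simp
  have "point (B, S, a) = vertex_point A" using \<sigma>(5) B(1) by (simp add: char_map_X)
  then have "A = glide_prod G {i \<in> S. a i = 1} \<otimes> B"
    using point_corner_iff[OF B(2) _ B(3) a, of A] assms(2) E_carrier by auto
  then show thesis
    using that[OF \<sigma>(1,2) B(1) _ _ B(2,3) a B(4)] \<sigma>(1,3) ax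
    by (simp add: turn_def glides_at_def)
qed

lemma glides_at_spanning:
  assumes "\<sigma> \<in> corners X (vertex_point A)" "A \<in> E"
  shows "glides_at \<sigma> \<in> spanning A"
  using assms
proof (rule cornerE)
  fix Q a B S
  assume S: "S \<noteq> {}" "B \<in> carrier G" "cubic_set S"
    and E: "\<And>T. T \<subseteq> S \<Longrightarrow> glide_prod G T \<otimes> B \<in> E"
    and A: "A = glide_prod G {i \<in> S. a i = (1::real)} \<otimes> B"
    and g: "glides_at \<sigma> = reversal G {i \<in> S. a i = 1} ` S"
  let ?T = "{i \<in> S. a i = 1}"
  have T: "?T \<subseteq> S" by auto
  have "glide_prod G R \<otimes> A \<in> E" if R: "R \<subseteq> reversal G ?T ` S" for R
  proof -
    obtain U where U: "U \<subseteq> S" "R = reversal G ?T ` U" using R by (auto simp: subset_image_iff)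
    have "sym_diff U ?T \<subseteq> S" using U by blast
    then show ?thesis
      unfolding A U(2) cubic_reversal_prod[OF S(3) T U(1) S(2)] by (rule E)
  qed
  then show ?thesis
    using S(1) cubic_reversal[OF S(3) T] by (auto simp: spanning_def g)
qed

text \<open>
  The chosen representative of the cube of \<open>(A, S)\<close> is based at some vertex \<open>[T]A\<close>; reversing all
  axes in \<open>T\<close> again leads back to \<open>A\<close> and to \<open>S\<close>.
\<close>

lemma corner_with_glides:
  assumes "S \<in> spanning A" "A \<in> E"
  obtains \<sigma> where "\<sigma> \<in> corners X (vertex_point A)" "glides_at \<sigma> = S"
proof -
  have S: "S \<noteq> {}" "cubic_set S" "\<And>T. T \<subseteq> S \<Longrightarrow> glide_prod G T \<otimes> A \<in> E"
    using assms(1) by (auto simp: spanning_def)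
  have A: "A \<in> carrier G" using assms(2) E_carrier by auto
  obtain Q T where Q: "Q \<in> cells X" "T \<subseteq> S" "cube_rep Q = (glide_prod G T \<otimes> A, reversal G T ` S)"
    using cell_exists[OF A S(2,3)] by blast
  define B where "B = glide_prod G T \<otimes> A"
  define S' where "S' = reversal G T ` S"
  define T' where "T' = reversal G T ` T"
  define a where "a = (\<lambda>i \<in> S'. if i \<in> T' then 1 else 0 :: real)"
  have ax: "axes X Q = S'" using Q(3) by (simp add: axes_X S'_def)
  have a: "a \<in> S' \<rightarrow>\<^sub>E {0, 1}" by (auto simp: a_def)
  have "T' \<subseteq> S'" unfolding T'_def S'_def using Q(2) by (rule image_mono)
  then have aT: "{i \<in> S'. a i = 1} = T'" by (auto simp: a_def)
  have B: "B \<in> carrier G" using cubic_prod_closed[OF S(2) Q(2)] A by (simp add: B_def)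
  have S': "cubic_set S'" unfolding S'_def by (rule cubic_reversal[OF S(2) Q(2)])
  have "glide_prod G T' \<otimes> B = A"
    using cubic_reversal_prod[OF S(2) Q(2) Q(2) A] A by (simp add: T'_def B_def)
  then have "point (B, S', a) = vertex_point A"
    using point_corner_iff[OF B A S' a] aT by simp
  then have "(Q, a) \<in> corners X (vertex_point A)"
    using Q(1,3) a S(1) ax by (auto simp: corners_def char_map_X B_def S'_def)
  moreover have "glides_at (Q, a) = S"
  proof -
    have "reversal G T' ` S' = reversal G (sym_diff T T) ` S"
      unfolding T'_def S'_def image_image
      by (rule image_cong) (simp_all only: reversal_reversal[OF cubicD(2)[OF S(2)] Q(2) Q(2)])
    then show ?thesis by (simp add: glides_at_def turn_def ax aT reversal_def)
  qed
  ultimately show thesis using that by blast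
qed

lemma corner_facts:
  assumes "\<sigma> \<in> corners X (vertex_point A)" "A \<in> E"
  shows "finite (axes X (fst \<sigma>))" "inj_on (turn \<sigma>) (axes X (fst \<sigma>))" "finite (glides_at \<sigma>)"
proof -
  obtain S T where S: "axes X (fst \<sigma>) = S" "cubic_set S" "turn \<sigma> = reversal G T"
    by (rule cornerE[OF assms])
  show 1: "finite (axes X (fst \<sigma>))" unfolding S(1) by (rule cubicD(1)[OF S(2)])
  show "inj_on (turn \<sigma>) (axes X (fst \<sigma>))"
    unfolding S(1,3) by (rule reversal_inj_on[OF cubicD(2)[OF S(2)]])
  show "finite (glides_at \<sigma>)" unfolding glides_at_def by (rule finite_imageI[OF 1])
qed

lemma bary_turn:
  assumes "\<sigma> \<in> corners X (vertex_point A)" "A \<in> E" "i \<in> axes X (fst \<sigma>)"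
  shows "bary \<sigma> v (turn \<sigma> i) = v i"
  using corner_facts(2)[OF assms(1,2)] assms(3)
  by (auto simp: bary_def zero_extension_def glides_at_def)

lemma bary_outside: "g \<notin> glides_at \<sigma> \<Longrightarrow> bary \<sigma> v g = 0"
  by (simp add: bary_def zero_extension_def)

text \<open>
  Seen from the vertex where it starts, a ray has the coordinates \<open>\<epsilon> * v i\<close> on all axes.  For
  \<open>\<epsilon> < 1\<close> they are less than \<open>1\<close>, so that points of rays can be compared from this vertex.
\<close>

lemma ray_eq_point:
  assumes \<sigma>: "\<sigma> \<in> corners X (vertex_point A)" "A \<in> E"
    and v: "v \<in> std_simplex (axes X (fst \<sigma>))" and \<epsilon>: "0 < \<epsilon>" "\<epsilon> < 1"
  shows "ray X \<sigma> v \<epsilon> = point (A, glides_at \<sigma>, \<lambda>g \<in> glides_at \<sigma>. \<epsilon> * bary \<sigma> v g)"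
    and "(\<lambda>g \<in> glides_at \<sigma>. \<epsilon> * bary \<sigma> v g) \<in> glides_at \<sigma> \<rightarrow>\<^sub>E {0..<1}"
proof -
  obtain Q a B S where c: "\<sigma> = (Q, a)" "Q \<in> cells X" "cube_rep Q = (B, S)" "axes X (fst \<sigma>) = S"
    "B \<in> carrier G" "cubic_set S" "a \<in> S \<rightarrow>\<^sub>E {0, 1}"
    "A = glide_prod G {i \<in> S. a i = 1} \<otimes> B" "turn \<sigma> = reversal G {i \<in> S. a i = 1}"
    "glides_at \<sigma> = reversal G {i \<in> S. a i = 1} ` S"
    by (rule cornerE[OF \<sigma>])
  let ?T = "{i \<in> S. a i = 1}"
  let ?y = "\<lambda>g \<in> glides_at \<sigma>. \<epsilon> * bary \<sigma> v g"
  let ?x = "\<lambda>i \<in> S. if a i = 0 then \<epsilon> * v i else 1 - \<epsilon> * v i"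
  have b: "bary \<sigma> v (reversal G ?T i) = v i" if "i \<in> S" for i
    using bary_turn[OF \<sigma>, of i v] that c(4,9) by simp
  have ev: "0 \<le> \<epsilon> * v i" "\<epsilon> * v i < 1" if "i \<in> S" for i
  proof -
    have "0 \<le> v i" "v i \<le> 1"
      using std_simplexD(1)[OF v] std_simplex_le_1[OF corner_facts(1)[OF \<sigma>] v] that c(4) by auto
    moreover from this have "\<epsilon> * v i \<le> \<epsilon>" using \<epsilon>(1) by (simp add: mult_left_le)
    ultimately show "0 \<le> \<epsilon> * v i" "\<epsilon> * v i < 1"
      using \<epsilon> by (simp, linarith)
  qed
  show y: "?y \<in> glides_at \<sigma> \<rightarrow>\<^sub>E {0..<1}"
    unfolding c(10) using b ev by (auto simp: PiE_iff)
  have "point (B, S, ?x) = point (glide_prod G ?T \<otimes> B, reversal G ?T ` S, ?y)"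
  proof (rule point_flip[OF c(5,6)])
    show "?T \<subseteq> S" by auto
    show "?x \<in> S \<rightarrow>\<^sub>E {0..1}" using ev by (auto simp: PiE_iff less_imp_le)
    show "?y \<in> reversal G ?T ` S \<rightarrow>\<^sub>E {0..1}"
      using y unfolding c(10) by (auto simp: PiE_iff less_imp_le)
    fix i assume i: "i \<in> S"
    then have "a i = 0 \<or> a i = 1" using c(7) by (auto simp: PiE_iff)
    then show "?y (reversal G ?T i) = reflect ?T ?x i"
      using i b[OF i] by (auto simp: reflect_def c(10))
  qed
  then show "ray X \<sigma> v \<epsilon> = point (A, glides_at \<sigma>, ?y)"
    using c by (simp add: ray_def char_map_X)
qed

lemma ray_eq_iff:
  assumes \<sigma>: "\<sigma> \<in> corners X (vertex_point A)" and \<tau>: "\<tau> \<in> corners X (vertex_point A)" and A: "A \<in> E"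
    and v: "v \<in> std_simplex (axes X (fst \<sigma>))" and w: "w \<in> std_simplex (axes X (fst \<tau>))"
    and \<epsilon>: "0 < \<epsilon>" "\<epsilon> < 1"
  shows "ray X \<sigma> v \<epsilon> = ray X \<tau> w \<epsilon> \<longleftrightarrow> bary \<sigma> v = bary \<tau> w"
proof -
  have ext: "zero_extension (glides_at \<rho>) (\<lambda>g \<in> glides_at \<rho>. \<epsilon> * bary \<rho> z g) = (\<lambda>g. \<epsilon> * bary \<rho> z g)"
    for \<rho> z by (auto simp: zero_extension_def bary_outside fun_eq_iff)
  have "cubic_set (glides_at \<sigma>)" "cubic_set (glides_at \<tau>)"
    using glides_at_spanning \<sigma> \<tau> A by (auto simp: spanning_def)
  then have "ray X \<sigma> v \<epsilon> = ray X \<tau> w \<epsilon> \<longleftrightarrow> (\<lambda>g. \<epsilon> * bary \<sigma> v g) = (\<lambda>g. \<epsilon> * bary \<tau> w g)"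
    unfolding ray_eq_point(1)[OF \<sigma> A v \<epsilon>] ray_eq_point(1)[OF \<tau> A w \<epsilon>]
    using point_eq_iff[OF _ _ _ ray_eq_point(2)[OF \<sigma> A v \<epsilon>] ray_eq_point(2)[OF \<tau> A w \<epsilon>]]
      A E_carrier by (auto simp: ext)
  also have "\<dots> \<longleftrightarrow> bary \<sigma> v = bary \<tau> w" using \<epsilon> by (auto simp: fun_eq_iff)
  finally show ?thesis .
qed

text \<open>
  Two rays agree at one time in \<open>]0, 1[\<close> exactly when they agree at all of them, so a germ is the
  same thing as its barycentric coordinates.
\<close>

lemma same_germ_iff:
  assumes A: "A \<in> E"
  shows "((\<sigma>, v), (\<tau>, w)) \<in> same_germ X (vertex_point A) \<longleftrightarrow>
    \<sigma> \<in> corners X (vertex_point A) \<and> v \<in> std_simplex (axes X (fst \<sigma>)) \<and>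
    \<tau> \<in> corners X (vertex_point A) \<and> w \<in> std_simplex (axes X (fst \<tau>)) \<and> bary \<sigma> v = bary \<tau> w"
proof -
  have "(\<forall>\<^sub>F \<epsilon> in at_right 0. ray X \<sigma> v \<epsilon> = ray X \<tau> w \<epsilon>) \<longleftrightarrow> bary \<sigma> v = bary \<tau> w"
    if c: "\<sigma> \<in> corners X (vertex_point A)" "v \<in> std_simplex (axes X (fst \<sigma>))"
      "\<tau> \<in> corners X (vertex_point A)" "w \<in> std_simplex (axes X (fst \<tau>))"
  proof -
    have "\<forall>\<^sub>F \<epsilon> in at_right (0::real). \<epsilon> \<in> {0<..<1}" by (rule eventually_at_right_real) simp
    then have "\<forall>\<^sub>F \<epsilon> in at_right 0. (ray X \<sigma> v \<epsilon> = ray X \<tau> w \<epsilon>) = (bary \<sigma> v = bary \<tau> w)"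
      by (rule eventually_mono) (use ray_eq_iff[OF c(1,3) A c(2,4)] in auto)
    then have "(\<forall>\<^sub>F \<epsilon> in at_right 0. ray X \<sigma> v \<epsilon> = ray X \<tau> w \<epsilon>)
        = (\<forall>\<^sub>F \<epsilon> in at_right (0::real). bary \<sigma> v = bary \<tau> w)"
      by (rule eventually_subst)
    then show ?thesis by (simp add: eventually_const)
  qed
  then show ?thesis unfolding same_germ_def by auto
qed

text \<open>
  For \<open>K\<close> the set of all axes this identifies the standard simplex of a corner with the simplex of
  barycentric coordinates on the glides leaving the vertex.
\<close>

lemma bary_face_image:
  assumes \<sigma>: "\<sigma> \<in> corners X (vertex_point A)" "A \<in> E" and K: "K \<subseteq> axes X (fst \<sigma>)"
  shows "bary \<sigma> ` {v \<in> std_simplex (axes X (fst \<sigma>)). \<forall>i \<in> axes X (fst \<sigma>) - K. v i = 0}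
    = barycentric (turn \<sigma> ` K)"
proof -
  let ?J = "axes X (fst \<sigma>)"
  note inj = corner_facts(2)[OF \<sigma>]
  have reindex: "sum u (turn \<sigma> ` K) = sum (u \<circ> turn \<sigma>) K" for u :: "'a \<Rightarrow> real"
    by (rule sum.reindex[OF inj_on_subset[OF inj K]])
  have sumK: "sum v K = sum v ?J" if "\<forall>i \<in> ?J - K. v i = 0" for v :: "'a \<Rightarrow> real"
    by (rule sum.mono_neutral_left[OF corner_facts(1)[OF \<sigma>] K that])
  show ?thesis
  proof (intro equalityI subsetI)
    fix u assume "u \<in> bary \<sigma> ` {v \<in> std_simplex ?J. \<forall>i \<in> ?J - K. v i = 0}"
    then obtain v where v: "u = bary \<sigma> v" "v \<in> std_simplex ?J" "\<forall>i \<in> ?J - K. v i = 0" by auto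
    have u: "u (turn \<sigma> i) = v i" if "i \<in> ?J" for i using bary_turn[OF \<sigma> that] v(1) by simp
    have out: "u g = 0" if "g \<notin> glides_at \<sigma>" for g using bary_outside[OF that] v(1) by simp
    have "sum u (turn \<sigma> ` K) = sum v K"
      unfolding reindex by (rule sum.cong) (use u K in auto)
    also have "\<dots> = 1" using sumK[OF v(3)] std_simplexD(2)[OF v(2)] by simp
    finally have "sum u (turn \<sigma> ` K) = 1" .
    moreover have "0 \<le> u g" for g
      using u out std_simplexD(1)[OF v(2)] by (cases "g \<in> glides_at \<sigma>") (auto simp: glides_at_def)
    moreover have "u g = 0" if "g \<notin> turn \<sigma> ` K" for g
      using u out v(3) that by (cases "g \<in> glides_at \<sigma>") (auto simp: glides_at_def)
    ultimately show "u \<in> barycentric (turn \<sigma> ` K)" by (simp add: barycentric_def)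
  next
    fix u assume "u \<in> barycentric (turn \<sigma> ` K)"
    then have u: "\<And>g. 0 \<le> u g" "\<And>g. g \<notin> turn \<sigma> ` K \<Longrightarrow> u g = 0" "sum u (turn \<sigma> ` K) = 1"
      by (auto simp: barycentric_def)
    define v where "v = (\<lambda>i \<in> ?J. u (turn \<sigma> i))"
    have v0: "\<forall>i \<in> ?J - K. v i = 0"
    proof
      fix i assume i: "i \<in> ?J - K"
      then have "turn \<sigma> i \<notin> turn \<sigma> ` K" using inj_on_image_mem_iff[OF inj _ K] by auto
      then show "v i = 0" using i u(2) by (simp add: v_def)
    qed
    have "sum v ?J = sum v K" using sumK[OF v0] by simp
    also have "\<dots> = sum (u \<circ> turn \<sigma>) K"
      by (rule sum.cong) (use K in \<open>auto simp: v_def\<close>)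
    finally have "sum v ?J = 1" using u(3) reindex by simp
    then have v: "v \<in> std_simplex ?J" using u(1) by (auto simp: std_simplex_def v_def)
    have "bary \<sigma> v = u"
    proof
      fix g
      show "bary \<sigma> v g = u g"
      proof (cases "g \<in> glides_at \<sigma>")
        case True
        then obtain i where i: "i \<in> ?J" "g = turn \<sigma> i" by (auto simp: glides_at_def)
        then show ?thesis using bary_turn[OF \<sigma> i(1)] by (simp add: v_def)
      next
        case False
        then have "g \<notin> turn \<sigma> ` K" using K by (auto simp: glides_at_def)
        then show ?thesis using bary_outside[OF False] u(2) by simp
      qed
    qed
    then show "u \<in> bary \<sigma> ` {v \<in> std_simplex ?J. \<forall>i \<in> ?J - K. v i = 0}" using v v0 by auto
  qed
qed

lemma bary_image:
  assumes "\<sigma> \<in> corners X (vertex_point A)" "A \<in> E"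
  shows "bary \<sigma> ` std_simplex (axes X (fst \<sigma>)) = barycentric (glides_at \<sigma>)"
  using bary_face_image[OF assms subset_refl] by (simp add: glides_at_def)

lemma bary_inj:
  assumes "\<sigma> \<in> corners X (vertex_point A)" "A \<in> E"
  shows "inj_on (bary \<sigma>) (std_simplex (axes X (fst \<sigma>)))"
proof (rule inj_onI)
  fix v w assume v: "v \<in> std_simplex (axes X (fst \<sigma>))" and w: "w \<in> std_simplex (axes X (fst \<sigma>))"
    and eq: "bary \<sigma> v = bary \<sigma> w"
  show "v = w"
  proof (rule extensionalityI[OF std_simplexD(3)[OF v] std_simplexD(3)[OF w]])
    fix i assume "i \<in> axes X (fst \<sigma>)"
    from bary_turn[OF assms this] show "v i = w i" using eq by metis
  qed
qed

lemma std_simplex_vertex: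
  "finite J \<Longrightarrow> i \<in> J \<Longrightarrow> (\<lambda>j \<in> J. if j = i then 1 else 0) \<in> std_simplex J"
  by (auto simp: std_simplex_def sum.delta)

lemma bary_vertex:
  assumes "\<sigma> \<in> corners X (vertex_point A)" "A \<in> E" "i \<in> axes X (fst \<sigma>)"
  shows "bary \<sigma> (\<lambda>j \<in> axes X (fst \<sigma>). if j = i then 1 else 0) = unit_coord (turn \<sigma> i)"
proof
  fix g
  show "bary \<sigma> (\<lambda>j \<in> axes X (fst \<sigma>). if j = i then 1 else 0) g = unit_coord (turn \<sigma> i) g"
  proof (cases "g \<in> glides_at \<sigma>")
    case True
    then obtain j where j: "j \<in> axes X (fst \<sigma>)" "g = turn \<sigma> j" by (auto simp: glides_at_def)
    have "turn \<sigma> j = turn \<sigma> i \<longleftrightarrow> j = i"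
      using inj_on_eq_iff[OF corner_facts(2)[OF assms(1,2)] j(1) assms(3)] .
    then show ?thesis
      using bary_turn[OF assms(1,2) j(1)] j by (simp add: unit_coord_def)
  next
    case False
    then have "g \<noteq> turn \<sigma> i" using assms(3) by (auto simp: glides_at_def)
    then show ?thesis using bary_outside[OF False] by (simp add: unit_coord_def)
  qed
qed

text \<open>
  The direction with given barycentric coordinates.  It does not refer to a corner, and this puts the
  simplices of all corners at \<open>A\<close> into a single space of coordinates.
\<close>

definition direction_with where
  "direction_with A u = {(\<tau>, w). \<tau> \<in> corners X (vertex_point A)
     \<and> w \<in> std_simplex (axes X (fst \<tau>)) \<and> bary \<tau> w = u}"

lemma direction_eq:
  assumes "A \<in> E" "\<sigma> \<in> corners X (vertex_point A)" "v \<in> std_simplex (axes X (fst \<sigma>))"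
  shows "direction X (vertex_point A) \<sigma> v = direction_with A (bary \<sigma> v)"
  unfolding direction_def direction_with_def
  using assms(2,3) by (auto simp: same_germ_iff[OF assms(1)])

lemma direction_with_inj:
  assumes "A \<in> E"
  shows "inj_on (direction_with A) (\<Union>S \<in> spanning A. barycentric S)"
proof (rule inj_onI)
  fix u u' assume u: "u \<in> (\<Union>S \<in> spanning A. barycentric S)"
    and eq: "direction_with A u = direction_with A u'"
  then obtain S where S: "S \<in> spanning A" "u \<in> barycentric S" by auto
  obtain \<sigma> where \<sigma>: "\<sigma> \<in> corners X (vertex_point A)" "glides_at \<sigma> = S"
    using corner_with_glides[OF S(1) assms] .
  then obtain v where v: "v \<in> std_simplex (axes X (fst \<sigma>))" "u = bary \<sigma> v"
    using bary_image[OF \<sigma>(1) assms] S(2) by auto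
  then have "(\<sigma>, v) \<in> direction_with A u" using \<sigma> by (simp add: direction_with_def)
  then have "(\<sigma>, v) \<in> direction_with A u'" unfolding eq .
  then show "u = u'" using v(2) by (simp add: direction_with_def)
qed

lemma link_face_eq:
  assumes "A \<in> E" "\<sigma> \<in> corners X (vertex_point A)" "K \<subseteq> axes X (fst \<sigma>)"
  shows "link_face X (vertex_point A) \<sigma> K = direction_with A ` barycentric (turn \<sigma> ` K)"
  unfolding link_face_def bary_face_image[OF assms(2,1,3), symmetric] image_image
  by (rule image_cong) (auto simp: direction_eq[OF assms(1,2)])

lemma link_simplex_eq:
  assumes "A \<in> E" "\<sigma> \<in> corners X (vertex_point A)"
  shows "link_simplex X (vertex_point A) \<sigma> = direction_with A ` barycentric (glides_at \<sigma>)"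
  unfolding link_simplex_def bary_image[OF assms(2,1), symmetric] image_image
  by (rule image_cong) (auto simp: direction_eq[OF assms])

lemma link_simplex_vertices_eq:
  assumes "A \<in> E" "\<sigma> \<in> corners X (vertex_point A)"
  shows "link_simplex_vertices X (vertex_point A) \<sigma>
    = (\<lambda>s. direction_with A (unit_coord s)) ` glides_at \<sigma>"
  unfolding link_simplex_vertices_def glides_at_def image_image
  by (rule image_cong)
    (simp_all add: direction_eq[OF assms] std_simplex_vertex corner_facts(1)[OF assms(2,1)]
      bary_vertex[OF assms(2,1)])

text \<open>
  In barycentric coordinates the simplices of two corners are spanned by sets of glides \<open>S\<close> and
  \<open>S'\<close> and intersect in the face spanned by \<open>S \<inter> S'\<close>.
\<close>

lemma link_is_simplicial_X:
  assumes "A \<in> E"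
  shows "link_is_simplicial X (vertex_point A)"
  unfolding link_is_simplicial_def
proof (intro conjI ballI)
  fix \<sigma> assume \<sigma>: "\<sigma> \<in> corners X (vertex_point A)"
  have "inj_on (direction_with A) (barycentric (glides_at \<sigma>))"
    using direction_with_inj[OF assms] glides_at_spanning[OF \<sigma> assms]
    by (rule_tac inj_on_subset) auto
  then have "inj_on (direction_with A \<circ> bary \<sigma>) (std_simplex (axes X (fst \<sigma>)))"
    using bary_inj[OF \<sigma> assms] bary_image[OF \<sigma> assms] by (intro comp_inj_on) simp_all
  moreover have "inj_on (direction X (vertex_point A) \<sigma>) (std_simplex (axes X (fst \<sigma>)))
      \<longleftrightarrow> inj_on (direction_with A \<circ> bary \<sigma>) (std_simplex (axes X (fst \<sigma>)))"
    by (rule inj_on_cong) (simp add: direction_eq[OF assms \<sigma>])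
  ultimately show "inj_on (direction X (vertex_point A) \<sigma>) (std_simplex (axes X (fst \<sigma>)))" by simp
next
  fix \<sigma> \<tau> assume \<sigma>: "\<sigma> \<in> corners X (vertex_point A)" and \<tau>: "\<tau> \<in> corners X (vertex_point A)"
  define K where "K = {i \<in> axes X (fst \<sigma>). turn \<sigma> i \<in> glides_at \<tau>}"
  define L where "L = {i \<in> axes X (fst \<tau>). turn \<tau> i \<in> glides_at \<sigma>}"
  have K: "turn \<sigma> ` K = glides_at \<sigma> \<inter> glides_at \<tau>" "K \<subseteq> axes X (fst \<sigma>)"
    unfolding K_def glides_at_def[of \<sigma>] by blast+
  have L: "turn \<tau> ` L = glides_at \<sigma> \<inter> glides_at \<tau>" "L \<subseteq> axes X (fst \<tau>)"
    unfolding L_def glides_at_def[of \<tau>] by blast+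
  have "link_simplex X (vertex_point A) \<sigma> \<inter> link_simplex X (vertex_point A) \<tau>
      = direction_with A ` (barycentric (glides_at \<sigma>) \<inter> barycentric (glides_at \<tau>))"
    unfolding link_simplex_eq[OF assms \<sigma>] link_simplex_eq[OF assms \<tau>]
    by (rule inj_on_image_Int[OF direction_with_inj[OF assms], symmetric])
      (use glides_at_spanning[OF \<sigma> assms] glides_at_spanning[OF \<tau> assms] in auto)
  also have "\<dots> = direction_with A ` barycentric (glides_at \<sigma> \<inter> glides_at \<tau>)"
    using corner_facts(3)[OF \<sigma> assms] corner_facts(3)[OF \<tau> assms] by (simp add: barycentric_Int)
  finally show "\<exists>K \<subseteq> axes X (fst \<sigma>). \<exists>L \<subseteq> axes X (fst \<tau>).
      link_simplex X (vertex_point A) \<sigma> \<inter> link_simplex X (vertex_point A) \<tau>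
        = link_face X (vertex_point A) \<sigma> K \<and>
      link_simplex X (vertex_point A) \<sigma> \<inter> link_simplex X (vertex_point A) \<tau>
        = link_face X (vertex_point A) \<tau> L"
    using K L link_face_eq[OF assms \<sigma> K(2)] link_face_eq[OF assms \<tau> L(2)] by metis
qed

abbreviation link_vertex where
  "link_vertex A s \<equiv> direction_with A (unit_coord s)"

lemma link_vertex_inj:
  assumes "A \<in> E"
  shows "inj_on (link_vertex A) (\<Union>(spanning A))"
proof (rule inj_onI)
  fix s t assume "s \<in> \<Union>(spanning A)" "t \<in> \<Union>(spanning A)" and eq: "link_vertex A s = link_vertex A t"
  then obtain S T where S: "S \<in> spanning A" "s \<in> S" "T \<in> spanning A" "t \<in> T" by auto
  have "finite S" "finite T" using S(1,3) by (simp_all add: spanning_def cubic_def)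
  then have "unit_coord s \<in> barycentric S" "unit_coord t \<in> barycentric T"
    using S(2,4) by (simp_all add: unit_coord_barycentric)
  then have "unit_coord s \<in> (\<Union>S \<in> spanning A. barycentric S)"
    "unit_coord t \<in> (\<Union>S \<in> spanning A. barycentric S)"
    using S(1,3) by (meson UN_I)+
  then have "unit_coord s = unit_coord t" using inj_onD[OF direction_with_inj[OF assms], OF eq] by simp
  then show "s = t" by (simp add: unit_coord_inj)
qed

lemma spans_link_simplex_iff:
  assumes "A \<in> E"
  shows "spans_link_simplex X (vertex_point A) V \<longleftrightarrow> (\<exists>S \<in> spanning A. V = link_vertex A ` S)"
proof
  assume "spans_link_simplex X (vertex_point A) V"
  then obtain \<sigma> where \<sigma>: "\<sigma> \<in> corners X (vertex_point A)"
    "link_simplex_vertices X (vertex_point A) \<sigma> = V"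
    by (auto simp: spans_link_simplex_def)
  then show "\<exists>S \<in> spanning A. V = link_vertex A ` S"
    using link_simplex_vertices_eq[OF assms \<sigma>(1)] glides_at_spanning[OF \<sigma>(1) assms] by auto
next
  assume "\<exists>S \<in> spanning A. V = link_vertex A ` S"
  then obtain S where S: "S \<in> spanning A" "V = link_vertex A ` S" by auto
  obtain \<sigma> where "\<sigma> \<in> corners X (vertex_point A)" "glides_at \<sigma> = S"
    using corner_with_glides[OF S(1) assms] .
  then show "spans_link_simplex X (vertex_point A) V"
    using link_simplex_vertices_eq[OF assms] S(2) by (auto simp: spans_link_simplex_def)
qed

lemma spans_link_simplex_image_iff:
  assumes "A \<in> E" "S \<subseteq> \<Union>(spanning A)"
  shows "spans_link_simplex X (vertex_point A) (link_vertex A ` S) \<longleftrightarrow> S \<in> spanning A"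
proof -
  have "link_vertex A ` S = link_vertex A ` S' \<longleftrightarrow> S = S'" if "S' \<in> spanning A" for S'
    using inj_on_image_eq_iff[OF link_vertex_inj[OF assms(1)] assms(2), of S'] that by auto
  then show ?thesis unfolding spans_link_simplex_iff[OF assms(1)] by auto
qed

lemma link_vertices_X:
  assumes "A \<in> E"
  shows "link_vertices X (vertex_point A) = link_vertex A ` \<Union>(spanning A)"
proof (intro equalityI subsetI)
  fix d assume "d \<in> link_vertices X (vertex_point A)"
  then obtain \<sigma> where \<sigma>: "\<sigma> \<in> corners X (vertex_point A)"
    "d \<in> link_simplex_vertices X (vertex_point A) \<sigma>" by (auto simp: link_vertices_def)
  then show "d \<in> link_vertex A ` \<Union>(spanning A)"
    using link_simplex_vertices_eq[OF assms \<sigma>(1)] glides_at_spanning[OF \<sigma>(1) assms] by auto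
next
  fix d assume "d \<in> link_vertex A ` \<Union>(spanning A)"
  then obtain S s where S: "S \<in> spanning A" "s \<in> S" "d = link_vertex A s" by auto
  obtain \<sigma> where \<sigma>: "\<sigma> \<in> corners X (vertex_point A)" "glides_at \<sigma> = S"
    using corner_with_glides[OF S(1) assms] .
  then show "d \<in> link_vertices X (vertex_point A)"
    using link_simplex_vertices_eq[OF assms \<sigma>(1)] S by (auto simp: link_vertices_def)
qed

text \<open>
  The flag condition at \<open>A\<close> is transferred from directions to glides along the injective map
  \<open>link_vertex A\<close>.
\<close>

lemma link_is_flag_iff:
  assumes "A \<in> E"
  shows "link_is_flag X (vertex_point A) \<longleftrightarrow>
    (\<forall>S \<subseteq> \<Union>(spanning A). finite S \<and> S \<noteq> {} \<and> pairwise (\<lambda>s t. {s, t} \<in> spanning A) S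
      \<longrightarrow> S \<in> spanning A)"
proof -
  note inj = link_vertex_inj[OF assms]
  have adj: "pairwise (link_adjacent X (vertex_point A)) (link_vertex A ` S)
      \<longleftrightarrow> pairwise (\<lambda>s t. {s, t} \<in> spanning A) S" if S: "S \<subseteq> \<Union>(spanning A)" for S
  proof -
    have "(link_vertex A s \<noteq> link_vertex A t
          \<longrightarrow> link_adjacent X (vertex_point A) (link_vertex A s) (link_vertex A t))
        \<longleftrightarrow> {s, t} \<in> spanning A" if st: "s \<in> S" "t \<in> S" "s \<noteq> t" for s t
    proof -
      have mem: "s \<in> \<Union>(spanning A)" "t \<in> \<Union>(spanning A)" using st(1,2) S by auto
      then have "link_vertex A s \<noteq> link_vertex A t"
        using inj_on_eq_iff[OF inj mem] st(3) by (simp only: not_False_eq_True)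
      then show ?thesis
        using spans_link_simplex_image_iff[OF assms, of "{s, t}"] mem
        by (simp only: link_adjacent_def image_insert image_empty insert_subset empty_subsetI
            simp_thms)
    qed
    then show ?thesis
      unfolding pairwise_image unfolding pairwise_def by (intro ball_cong imp_cong refl)
  qed
  have fin: "finite (link_vertex A ` S) \<longleftrightarrow> finite S" if "S \<subseteq> \<Union>(spanning A)" for S
    by (rule finite_image_iff[OF inj_on_subset[OF inj that]])
  show ?thesis
    unfolding link_is_flag_def link_vertices_X[OF assms] all_subset_image
    using adj fin spans_link_simplex_image_iff[OF assms] by auto
qed

section \<open>Flag links, regular sets and the 3-cube condition\<close>

lemma pair_spanning_iff:
  assumes "A \<in> E" "s \<noteq> t"
  shows "{s, t} \<in> spanning A \<longleftrightarrow> (s, t) \<in> indep \<and> s \<otimes> A \<in> E \<and> t \<otimes> A \<in> E \<and> s \<otimes> t \<otimes> A \<in> E"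
proof
  assume st: "{s, t} \<in> spanning A"
  then have c: "cubic_set {s, t}" and E: "\<And>T. T \<subseteq> {s, t} \<Longrightarrow> glide_prod G T \<otimes> A \<in> E"
    by (auto simp: spanning_def)
  have i: "(s, t) \<in> indep" using indep_setD[OF cubicD(2)[OF c]] assms(2) by auto
  then have "s \<in> glides" "t \<in> glides" using indep_subset by auto
  then show "(s, t) \<in> indep \<and> s \<otimes> A \<in> E \<and> t \<otimes> A \<in> E \<and> s \<otimes> t \<otimes> A \<in> E"
    using i E[of "{s}"] E[of "{t}"] E[of "{s, t}"] glide_prod_pair(3)[OF i]
    by (simp add: glide_prod_singleton)
next
  assume st: "(s, t) \<in> indep \<and> s \<otimes> A \<in> E \<and> t \<otimes> A \<in> E \<and> s \<otimes> t \<otimes> A \<in> E"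
  then have g: "s \<in> glides" "t \<in> glides" using indep_subset by auto
  have "glide_prod G T \<otimes> A \<in> E" if "T \<subseteq> {s, t}" for T
  proof -
    have "T = {} \<or> T = {s} \<or> T = {t} \<or> T = {s, t}" using that by blast
    moreover have "A \<in> carrier G" using assms(1) E_carrier by auto
    ultimately show ?thesis
      using st g assms(1) glide_prod_pair(3)[of s t] by (elim disjE) (simp_all add: glide_prod_singleton)
  qed
  then show "{s, t} \<in> spanning A" using cubic_pair st by (auto simp: spanning_def)
qed

lemma mem_spanning_iff:
  assumes "A \<in> E"
  shows "s \<in> \<Union>(spanning A) \<longleftrightarrow> s \<in> glides \<and> s \<otimes> A \<in> E"
proof
  assume "s \<in> \<Union>(spanning A)"
  then obtain S where S: "s \<in> S" "cubic_set S" "\<And>T. T \<subseteq> S \<Longrightarrow> glide_prod G T \<otimes> A \<in> E"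
    by (auto simp: spanning_def)
  then have "s \<in> glides" by (auto simp: cubic_def independent_glides_def)
  then show "s \<in> glides \<and> s \<otimes> A \<in> E" using S(3)[of "{s}"] S(1) glide_prod_singleton by simp
next
  assume s: "s \<in> glides \<and> s \<otimes> A \<in> E"
  have "A \<in> carrier G" using assms E_carrier by auto
  then have "{s} \<in> spanning A"
    using s assms cubic_singleton by (auto simp: spanning_def subset_singleton_iff glide_prod_singleton)
  then show "s \<in> \<Union>(spanning A)" by auto
qed

text \<open>
  The hypothesis on \<open>S\<close> in the definition of a regular set; it says that \<open>S\<close> is a set of vertices of
  the link of \<open>A\<close> that are pairwise adjacent.
\<close>

definition pairwise_in_E where
  "pairwise_in_E A S \<longleftrightarrow> finite S \<and> indep_set S \<and> (\<forall>s \<in> S. s \<otimes> A \<in> E)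
     \<and> (\<forall>s \<in> S. \<forall>t \<in> S. s \<noteq> t \<longrightarrow> s \<otimes> t \<otimes> A \<in> E)"

lemma regular_iff:
  "regular G glides indep E \<longleftrightarrow> (\<forall>A \<in> E. \<forall>S. pairwise_in_E A S \<longrightarrow> cubic_set S)"
  unfolding regular_def pairwise_in_E_def ..

text \<open>
  Since two independent glides always form a cubic set, adjacency in the link of \<open>A\<close> is only a
  matter of independence and of membership in \<open>E\<close>.
\<close>

lemma link_is_flag_iff_spanning:
  assumes "A \<in> E"
  shows "link_is_flag X (vertex_point A) \<longleftrightarrow>
    (\<forall>S. S \<noteq> {} \<and> pairwise_in_E A S \<longrightarrow> S \<in> spanning A)"
proof -
  have "S \<subseteq> \<Union>(spanning A) \<and> finite S \<and> pairwise (\<lambda>s t. {s, t} \<in> spanning A) S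
      \<longleftrightarrow> pairwise_in_E A S" for S
  proof -
    have 1: "S \<subseteq> \<Union>(spanning A) \<longleftrightarrow> S \<subseteq> glides \<and> (\<forall>s \<in> S. s \<otimes> A \<in> E)"
      using mem_spanning_iff[OF assms] by (meson subset_iff)
    have 2: "pairwise (\<lambda>s t. {s, t} \<in> spanning A) S \<longleftrightarrow>
        (\<forall>s \<in> S. \<forall>t \<in> S. s \<noteq> t \<longrightarrow> (s, t) \<in> indep \<and> s \<otimes> A \<in> E \<and> t \<otimes> A \<in> E \<and> s \<otimes> t \<otimes> A \<in> E)"
      unfolding pairwise_def using pair_spanning_iff[OF assms] by metis
    show ?thesis
      unfolding 1 2 unfolding pairwise_in_E_def independent_glides_def pairwise_def
      by (intro iffI conjI ballI impI; elim conjE; simp)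
  qed
  then show ?thesis unfolding link_is_flag_iff[OF assms] by metis
qed

lemma nonpositively_curved_iff:
  "nonpositively_curved X \<longleftrightarrow> (\<forall>A \<in> E. \<forall>S. S \<noteq> {} \<and> pairwise_in_E A S \<longrightarrow> S \<in> spanning A)"
  unfolding nonpositively_curved_def simple_complex_def zero_cells_X
  using link_is_simplicial_X link_is_flag_iff_spanning by simp

definition three_cube_condition where
  "three_cube_condition \<longleftrightarrow> (\<forall>A \<in> E. \<forall>s1 \<in> glides. \<forall>s2 \<in> glides. \<forall>s3 \<in> glides.
       (s1, s2) \<in> indep \<and> (s1, s3) \<in> indep \<and> (s2, s3) \<in> indep \<and>
       s1 \<otimes> A \<in> E \<and> s2 \<otimes> A \<in> E \<and> s3 \<otimes> A \<in> E \<and>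
       s1 \<otimes> s2 \<otimes> A \<in> E \<and> s1 \<otimes> s3 \<otimes> A \<in> E \<and> s2 \<otimes> s3 \<otimes> A \<in> E
       \<longrightarrow> s1 \<otimes> s2 \<otimes> s3 \<otimes> A \<in> E)"

text \<open>
  By induction on \<open>T\<close>.  If \<open>T\<close> has three different elements \<open>a\<close>, \<open>b\<close>, \<open>c\<close>, the 3-cube condition
  is applied at the vertex \<open>B = [R]A\<close> with \<open>R = T - {a, b, c}\<close>; the other seven vertices of this
  3-cube are given by proper subsets of \<open>T\<close>.
\<close>

lemma glide_prod_in_E:
  assumes three: three_cube_condition and A: "A \<in> E" and S: "pairwise_in_E A S"
    and "T \<subseteq> S"
  shows "glide_prod G T \<otimes> A \<in> E"
proof -
  have fin: "finite S" and ind: "indep_set S" and one: "\<And>s. s \<in> S \<Longrightarrow> s \<otimes> A \<in> E"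
    and two: "\<And>s t. s \<in> S \<Longrightarrow> t \<in> S \<Longrightarrow> s \<noteq> t \<Longrightarrow> s \<otimes> t \<otimes> A \<in> E"
    using S by (auto simp: pairwise_in_E_def)
  have AG: "A \<in> carrier G" using A E_carrier by auto
  have "finite T" using assms(4) fin finite_subset by auto
  then show ?thesis using assms(4)
  proof (induction T rule: finite_psubset_induct)
    case (psubset T)
    have gl: "s \<in> glides" "s \<in> carrier G" if "s \<in> T" for s
      using that psubset.prems ind glide_carrier by (auto simp: independent_glides_def)
    have indT: "(s, t) \<in> indep" if "s \<in> T" "t \<in> T" "s \<noteq> t" for s t
      using indep_setD[OF ind] psubset.prems that by auto
    show ?case
    proof (cases "\<exists>a \<in> T. \<exists>b \<in> T. \<exists>c \<in> T. a \<noteq> b \<and> a \<noteq> c \<and> b \<noteq> c")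
      case True
      then obtain a b c where abc: "a \<in> T" "b \<in> T" "c \<in> T" "a \<noteq> b" "a \<noteq> c" "b \<noteq> c" by blast
      define R where "R = T - {a, b, c}"
      define B where "B = glide_prod G R \<otimes> A"
      have sub: "finite U" "indep_set U" if "U \<subseteq> T" for U
        using that psubset.prems psubset.hyps ind indep_set_subset finite_subset by blast+
      have R: "finite R" "indep_set R" using sub[of R] by (auto simp: R_def)
      have BG: "B \<in> carrier G" using R AG by (simp add: B_def)
      have below: "glide_prod G U \<otimes> A \<in> E" if "U \<subset> T" for U
        using psubset.IH[OF that] that psubset.prems by blast
      have ins: "glide_prod G (insert s U) \<otimes> A = s \<otimes> (glide_prod G U \<otimes> A)"
        if "insert s U \<subseteq> T" "s \<notin> U" for s U
      proof -
        have "finite U" "indep_set (insert s U)" "indep_set U" "s \<in> carrier G"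
          using sub[of U] sub[of "insert s U"] that gl by auto
        then show ?thesis using glide_prod_insert[of U s] that(2) AG by (simp add: m_assoc)
      qed
      have m: "glide_prod G (insert s R) \<otimes> A = s \<otimes> B" if "s \<in> {a, b, c}" for s
        using ins[of s R] that abc by (auto simp: R_def B_def)
      have mm: "glide_prod G (insert s (insert t R)) \<otimes> A = s \<otimes> t \<otimes> B"
        if "s \<in> {a, b, c}" "t \<in> {a, b, c}" "s \<noteq> t" for s t
        using ins[of s "insert t R"] m[of t] that abc gl BG by (auto simp: R_def m_assoc)
      have "B \<in> E" using below[of R] abc by (auto simp: R_def B_def)
      moreover have "s \<otimes> B \<in> E" if "s \<in> {a, b, c}" for s
      proof -
        have "insert s R \<subset> T" using that abc by (auto simp: R_def)
        then show ?thesis using below[of "insert s R"] m[OF that] by simp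
      qed
      moreover have "s \<otimes> t \<otimes> B \<in> E" if "s \<in> {a, b, c}" "t \<in> {a, b, c}" "s \<noteq> t" for s t
      proof -
        have "insert s (insert t R) \<subset> T" using that abc by (auto simp: R_def)
        then show ?thesis using below[of "insert s (insert t R)"] mm[OF that] by simp
      qed
      ultimately have "a \<otimes> b \<otimes> c \<otimes> B \<in> E"
        using three[unfolded three_cube_condition_def, rule_format, of B a b c] abc gl indT by simp
      also have "a \<otimes> b \<otimes> c \<otimes> B = a \<otimes> (b \<otimes> c \<otimes> B)"
        using abc gl BG by (simp add: m_assoc)
      also have "\<dots> = a \<otimes> (glide_prod G (insert b (insert c R)) \<otimes> A)"
        using mm[of b c] abc by simp
      also have "\<dots> = glide_prod G (insert a (insert b (insert c R))) \<otimes> A"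
        by (rule ins[symmetric]) (use abc in \<open>auto simp: R_def\<close>)
      also have "insert a (insert b (insert c R)) = T" using abc by (auto simp: R_def)
      finally show ?thesis .
    next
      case False
      then have "T = {} \<or> (\<exists>a \<in> T. T = {a}) \<or> (\<exists>a \<in> T. \<exists>b \<in> T. a \<noteq> b \<and> T = {a, b})"
        by blast
      then consider "T = {}" | a where "a \<in> T" "T = {a}"
        | a b where "a \<in> T" "b \<in> T" "a \<noteq> b" "T = {a, b}" by blast
      then show ?thesis
      proof cases
        case 1
        then show ?thesis using A AG by simp
      next
        case 2
        then show ?thesis using gl one psubset.prems by (simp add: glide_prod_singleton)
      next
        case 3
        then show ?thesis
          using glide_prod_pair(3)[OF indT[OF 3(1-3)]] two[of a b] psubset.prems by simp
      qed
    qed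
  qed
qed

text \<open>
  A clique of the link spans a simplex exactly when it is cubic and all vertices of its cube lie in
  \<open>E\<close>.  That all cliques are cubic is regularity; the other property follows from the 3-cube
  condition, and for cliques of three glides it gives this condition back.
\<close>

lemma nonpositively_curved_iff_regular:
  "nonpositively_curved X \<longleftrightarrow> regular G glides indep E \<and> three_cube_condition"
proof
  assume "nonpositively_curved X"
  then have span: "S \<in> spanning A" if "A \<in> E" "S \<noteq> {}" "pairwise_in_E A S" for A S
    using that by (simp add: nonpositively_curved_iff)
  \<comment> \<open>The empty set spans no simplex of the link, but regularity speaks of it as well.\<close>
  have "cubic_set S" if "A \<in> E" "pairwise_in_E A S" for A S
    using span[OF that(1) _ that(2)] cubic_empty by (cases "S = {}") (auto simp: spanning_def)
  then have "regular G glides indep E" by (simp add: regular_iff)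
  moreover have three_cube_condition
    unfolding three_cube_condition_def
  proof (intro ballI impI, elim conjE)
    fix A a b c
    assume A: "A \<in> E" and i: "(a, b) \<in> indep" "(a, c) \<in> indep" "(b, c) \<in> indep"
      and g: "a \<in> glides" "b \<in> glides" "c \<in> glides"
      and E: "a \<otimes> A \<in> E" "b \<otimes> A \<in> E" "c \<otimes> A \<in> E"
        "a \<otimes> b \<otimes> A \<in> E" "a \<otimes> c \<otimes> A \<in> E" "b \<otimes> c \<otimes> A \<in> E"
    have ne: "a \<noteq> b" "a \<noteq> c" "b \<noteq> c" using i glide_prod_pair(1) by auto
    have ind: "indep_set {a, b, c}"
      using g i indep_sym by (auto simp: independent_glides_def pairwise_def)
    have "pairwise_in_E A {a, b, c}"
      using ind E i[THEN indep_commute, THEN sym] by (auto simp: pairwise_in_E_def)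
    then have "{a, b, c} \<in> spanning A" using span[OF A] by simp
    then have "glide_prod G {a, b, c} \<otimes> A \<in> E" by (simp add: spanning_def)
    moreover have "glide_prod G {a, b, c} = a \<otimes> (b \<otimes> c)"
      using glide_prod_insert[of "{b, c}" a] ind ne glide_prod_pair(3)[OF i(3)] by simp
    ultimately show "a \<otimes> b \<otimes> c \<otimes> A \<in> E" using g glide_carrier by (simp add: m_assoc)
  qed
  ultimately show "regular G glides indep E \<and> three_cube_condition" ..
next
  assume r: "regular G glides indep E \<and> three_cube_condition"
  have "S \<in> spanning A" if "A \<in> E" "S \<noteq> {}" "pairwise_in_E A S" for A S
  proof -
    have "cubic_set S"
      using r that(1,3) by (simp add: regular_iff)
    then show ?thesis using glide_prod_in_E r that by (auto simp: spanning_def)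
  qed
  then show "nonpositively_curved X" by (simp add: nonpositively_curved_iff)
qed

end

theorem theorem3p3:
  fixes G :: "('a, 'b) monoid_scheme"
    and glides :: "'a set" and indep :: "('a \<times> 'a) set" and E :: "'a set"
  assumes "gliding_system G glides indep"
    and "E \<subseteq> carrier G"
  shows "nonpositively_curved (glide_complex G glides indep E) \<longleftrightarrow>
    regular G glides indep E \<and>
    (\<forall>A \<in> E. \<forall>s1 \<in> glides. \<forall>s2 \<in> glides. \<forall>s3 \<in> glides.
       (s1, s2) \<in> indep \<and> (s1, s3) \<in> indep \<and> (s2, s3) \<in> indep \<and>
       s1 \<otimes>\<^bsub>G\<^esub> A \<in> E \<and> s2 \<otimes>\<^bsub>G\<^esub> A \<in> E \<and> s3 \<otimes>\<^bsub>G\<^esub> A \<in> E \<and>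
       s1 \<otimes>\<^bsub>G\<^esub> s2 \<otimes>\<^bsub>G\<^esub> A \<in> E \<and> s1 \<otimes>\<^bsub>G\<^esub> s3 \<otimes>\<^bsub>G\<^esub> A \<in> E \<and> s2 \<otimes>\<^bsub>G\<^esub> s3 \<otimes>\<^bsub>G\<^esub> A \<in> E
       \<longrightarrow> s1 \<otimes>\<^bsub>G\<^esub> s2 \<otimes>\<^bsub>G\<^esub> s3 \<otimes>\<^bsub>G\<^esub> A \<in> E)"
proof -
  interpret glide_subset G glides indep E
    using assms by (simp add: glide_subset_def glide_subset_axioms_def)
  show ?thesis
    using nonpositively_curved_iff_regular unfolding three_cube_condition_def .
qed

end
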